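(* Let $\Delta t>0$ and let $\mathbf m_h^n\in\mathbf S_h^1$ satisfy $|\mathbf m_h^n(\mathbf z)|=1$ for all $\mathbf z\in\mathcal Q$. Define $$T_h(\mathbf m_h^n)=\{\mathbf w_h\in\mathbf S_h^1:\mathbf w_h(\mathbf z)\cdot\mathbf m_h^n(\mathbf z)=0\ \ \forall\mathbf z\in\mathcal Q\}.$$ Then the scheme: find $\widetilde{\mathbf m}_h^{n+1}\in\mathbf S_h^1$ with $$\Big(\tfrac{\widetilde{\mathbf m}_h^{n+1}-\mathbf m_h^n}{\Delta t},\mathbf v_h\Big)_h=-\big(\mathbf m_h^n\times(\mathbf m_h^n\times\widetilde\Delta_h\widetilde{\mathbf m}_h^{n+1}),\mathbf v_h\big)_h\quad\forall\,\mathbf v_h\in\mathbf S_h^1,\qquad\mathbf m_h^{n+1}=I_h\Big(\frac{\widetilde{\mathbf m}_h^{n+1}}{|\widetilde{\mathbf m}_h^{n+1}|}\Big),$$ is equivalent, through $\mathbf u_h^{n+1}=(\widetilde{\mathbf m}_h^{n+1}-\mathbf m_h^n)/\Delta t$, to the tangent plane scheme: find $\mathbf u_h^{n+1}\in T_h(\mathbf m_h^n)$ with $$(\mathbf u_h^{n+1},\mathbf w_h)_h+\Delta t\,(\nabla\mathbf u_h^{n+1},\nabla\mathbf w_h)_h+(\nabla\mathbf m_h^n,\nabla\mathbf w_h)_h=0\quad\forall\,\mathbf w_h\in T_h(\mathbf m_h^n),\qquad\mathbf m_h^{n+1}=I_h\Big(\frac{\mathbf m_h^n+\Delta t\,\mathbf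 u_h^{n+1}}{|\mathbf m_h^n+\Delta t\,\mathbf u_h^{n+1}|}\Big).$$
   Context: Mesh and space: $d\in\{1,2,3\}$; $\Omega\subset\mathbb R^d$ is a bounded rectangular domain (product of intervals). $\mathscr T_h$ is a mesh of $\Omega$ into Cartesian boxes generated by the tensor product of one-dimensional partitions in each coordinate direction (from a shape-regular, quasi-uniform family). $Q_1(K)$ is the space of polynomials on $K$ of degree at most $1$ in each variable, and $\mathbf S_h^1=\{\mathbf v_h\in H^1(\Omega)^3:\mathbf v_h|_K\in Q_1(K)^3\ \forall K\in\mathscr T_h\}$. $\mathcal Q_K$ is the set of vertices of $K$, $\mathcal Q$ the set of all mesh vertices (finite element nodes), $I_h$ the nodal $Q_1$ interpolation operator at $\mathcal Q$ (applied componentwise). Quadrature: the tensor-product two-point Gauss--Lobatto rule, with weights $\omega_{K,\mathbf z}=2^{-d}|K|$, $\mathbf z\in\mathcal Q_K$. For functions with nodal values, $(\mathbf v,\mathbf w)_h=\sum_K\sum_{\mathbf z\in\mathcal Q_K}\omega_{K,\mathbf z}\,\mathbf v(\mathbf z)\cdot\mathbf w(\mathbf z)$; for gradients, $(\nabla\mathbf v,\nabla\mathbf w)_h=\sum_K\sum_{\mathbf z\in\mathcal Q_K}\omega_{K,\mathbf z}\nabla(\mathbf v|_K)(\mathbf z)\cdot\nabla(\mathbf w|_K)(\mathbf z)$ (Frobenius product, gradients taken elementwise). The discrete Laplacian $\widetilde\Delta_h:\mathbf S_h^1\to\mathbf S_h^1$ is defined by $(\widetilde\Delta_h\mathbf v_h,\mathbf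 w_h)_h=-(\nabla\mathbf v_h,\nabla\mathbf w_h)_h$ for all $\mathbf w_h\in\mathbf S_h^1$. *)

theory Defs
  imports "HOL-Analysis.Analysis"
begin

definition partial :: "'d::finite \<Rightarrow> (real ^ 'd \<Rightarrow> real) \<Rightarrow> real ^ 'd \<Rightarrow> real" where
  "partial i f x = frechet_derivative f (at x) (axis i 1)"

fun Ck :: "nat \<Rightarrow> (real ^ 'd::finite \<Rightarrow> real) \<Rightarrow> bool" where
  "Ck 0 f \<longleftrightarrow> continuous_on UNIV f"
| "Ck (Suc k) f \<longleftrightarrow> f differentiable_on UNIV \<and> (\<forall>i. Ck k (partial i f))"

definition test_function :: "(real ^ 'd::finite) set \<Rightarrow> (real ^ 'd \<Rightarrow> real) \<Rightarrow> bool" where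
  "test_function \<Omega> \<phi> \<longleftrightarrow>
     (\<forall>k. Ck k \<phi>) \<and> compact (closure {x. \<phi> x \<noteq> 0}) \<and> closure {x. \<phi> x \<noteq> 0} \<subseteq> \<Omega>"

definition L2 :: "(real ^ 'd::finite) set \<Rightarrow> (real ^ 'd \<Rightarrow> real) set" where
  "L2 \<Omega> = {f. f \<in> borel_measurable (lebesgue_on \<Omega>) \<and> integrable (lebesgue_on \<Omega>) (\<lambda>x. (f x)\<^sup>2)}"

definition weak_partial ::
  "(real ^ 'd::finite) set \<Rightarrow> 'd \<Rightarrow> (real ^ 'd \<Rightarrow> real) \<Rightarrow> (real ^ 'd \<Rightarrow> real) \<Rightarrow> bool" where
  "weak_partial \<Omega> i f g \<longleftrightarrow>
     (\<forall>\<phi>. test_function \<Omega> \<phi> \<longrightarrow>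
        integral\<^sup>L (lebesgue_on \<Omega>) (\<lambda>x. f x * partial i \<phi> x) =
        - integral\<^sup>L (lebesgue_on \<Omega>) (\<lambda>x. g x * \<phi> x))"

definition H1 :: "(real ^ 'd::finite) set \<Rightarrow> (real ^ 'd \<Rightarrow> real) set" where
  "H1 \<Omega> = {f \<in> L2 \<Omega>. \<forall>i. \<exists>g \<in> L2 \<Omega>. weak_partial \<Omega> i f g}"

text \<open>The list \<open>P i\<close> contains the points of the one-dimensional partition in direction \<open>i\<close>.
  An element is addressed by a multi-index \<open>j\<close>: it is the product over \<open>i\<close> of the intervals
  between points number \<open>j i\<close> and \<open>Suc (j i)\<close>.\<close>

definition tensor_partition ::
  "real ^ 'd::finite \<Rightarrow> real ^ 'd \<Rightarrow> ('d \<Rightarrow> real list) \<Rightarrow> bool" where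
  "tensor_partition a b P \<longleftrightarrow>
     (\<forall>i. 2 \<le> length (P i) \<and> sorted_wrt (<) (P i) \<and> hd (P i) = a $ i \<and> last (P i) = b $ i)"

definition elements :: "('d::finite \<Rightarrow> real list) \<Rightarrow> ('d \<Rightarrow> nat) set" where
  "elements P = {j. \<forall>i. Suc (j i) < length (P i)}"

definition cell :: "('d::finite \<Rightarrow> real list) \<Rightarrow> ('d \<Rightarrow> nat) \<Rightarrow> (real ^ 'd) set" where
  "cell P j = cbox (\<chi> i. P i ! j i) (\<chi> i. P i ! Suc (j i))"

definition vertices :: "('d::finite \<Rightarrow> real list) \<Rightarrow> ('d \<Rightarrow> nat) \<Rightarrow> (real ^ 'd) set" where
  "vertices P j = {z. \<forall>i. z $ i = P i ! j i \<or> z $ i = P i ! Suc (j i)}"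

definition nodes :: "('d::finite \<Rightarrow> real list) \<Rightarrow> (real ^ 'd) set" where
  "nodes P = (\<Union>j\<in>elements P. vertices P j)"

definition Q1 :: "(real ^ 'd::finite \<Rightarrow> real) set" where
  "Q1 = {p. \<exists>c :: 'd set \<Rightarrow> real. \<forall>x. p x = (\<Sum>S\<in>UNIV. c S * (\<Prod>i\<in>S. x $ i))}"

text \<open>A finite element function is represented by its values on the closure of \<open>\<Omega>\<close> (its
  continuous representative, since the polynomial pieces are attained on the closed cells).
  It is set to \<open>0\<close> elsewhere, so that equality of finite element functions is equality in HOL.\<close>

definition S1 ::
  "(real ^ 'd::finite) set \<Rightarrow> ('d \<Rightarrow> real list) \<Rightarrow> (real ^ 'd \<Rightarrow> real ^ 3) set" where
  "S1 \<Omega> P = {v.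
     (\<forall>k. (\<lambda>x. v x $ k) \<in> H1 \<Omega>) \<and>
     (\<forall>j\<in>elements P. \<forall>k. \<exists>p\<in>Q1. \<forall>x\<in>cell P j. v x $ k = p x) \<and>
     (\<forall>x. x \<notin> closure \<Omega> \<longrightarrow> v x = 0)}"

text \<open>The definite descriptions in \<open>nodal_interp\<close> and \<open>discrete_laplacian\<close> are well posed: a member of
  \<open>S1\<close> is determined by its nodal values, which can be prescribed arbitrarily, and \<open>inner_h\<close> is an
  inner product on \<open>S1\<close>.\<close>

definition nodal_interp ::
  "(real ^ 'd::finite) set \<Rightarrow> ('d \<Rightarrow> real list) \<Rightarrow> (real ^ 'd \<Rightarrow> real ^ 3) \<Rightarrow> real ^ 'd \<Rightarrow> real ^ 3" where
  "nodal_interp \<Omega> P f = (THE v. v \<in> S1 \<Omega> P \<and> (\<forall>z\<in>nodes P. v z = f z))"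

definition weight :: "('d::finite \<Rightarrow> real list) \<Rightarrow> ('d \<Rightarrow> nat) \<Rightarrow> real" where
  "weight P j = measure lborel (cell P j) / 2 ^ CARD('d)"

definition inner_h ::
  "('d::finite \<Rightarrow> real list) \<Rightarrow> (real ^ 'd \<Rightarrow> real ^ 3) \<Rightarrow> (real ^ 'd \<Rightarrow> real ^ 3) \<Rightarrow> real" where
  "inner_h P v w = (\<Sum>j\<in>elements P. \<Sum>z\<in>vertices P j. weight P j * (v z \<bullet> w z))"

text \<open>The derivative within the closed cell at one of its vertices is the gradient of the
  restriction to that cell. The inner product on \<open>real ^ 'd ^ 3\<close> is the Frobenius product.\<close>

definition grad_inner_h ::
  "('d::finite \<Rightarrow> real list) \<Rightarrow> (real ^ 'd \<Rightarrow> real ^ 3) \<Rightarrow> (real ^ 'd \<Rightarrow> real ^ 3) \<Rightarrow> real" where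
  "grad_inner_h P v w = (\<Sum>j\<in>elements P. \<Sum>z\<in>vertices P j.
     weight P j * (jacobian v (at z within cell P j) \<bullet> jacobian w (at z within cell P j)))"

definition discrete_laplacian ::
  "(real ^ 'd::finite) set \<Rightarrow> ('d \<Rightarrow> real list) \<Rightarrow> (real ^ 'd \<Rightarrow> real ^ 3) \<Rightarrow> real ^ 'd \<Rightarrow> real ^ 3" where
  "discrete_laplacian \<Omega> P v =
     (THE L. L \<in> S1 \<Omega> P \<and> (\<forall>w\<in>S1 \<Omega> P. inner_h P L w = - grad_inner_h P v w))"

definition tangent_space ::
  "(real ^ 'd::finite) set \<Rightarrow> ('d \<Rightarrow> real list) \<Rightarrow> (real ^ 'd \<Rightarrow> real ^ 3) \<Rightarrow> (real ^ 'd \<Rightarrow> real ^ 3) set" where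
  "tangent_space \<Omega> P m = {w \<in> S1 \<Omega> P. \<forall>z\<in>nodes P. w z \<bullet> m z = 0}"

definition projection_scheme ::
  "(real ^ 'd::finite) set \<Rightarrow> ('d \<Rightarrow> real list) \<Rightarrow> real \<Rightarrow> (real ^ 'd \<Rightarrow> real ^ 3) \<Rightarrow>
   (real ^ 'd \<Rightarrow> real ^ 3) \<Rightarrow> (real ^ 'd \<Rightarrow> real ^ 3) \<Rightarrow> bool" where
  "projection_scheme \<Omega> P \<Delta>t m mt m' \<longleftrightarrow>
     mt \<in> S1 \<Omega> P \<and>
     (\<forall>v\<in>S1 \<Omega> P.
        inner_h P (\<lambda>x. (mt x - m x) /\<^sub>R \<Delta>t) v =
        - inner_h P (\<lambda>x. cross3 (m x) (cross3 (m x) (discrete_laplacian \<Omega> P mt x))) v) \<and>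
     m' = nodal_interp \<Omega> P (\<lambda>x. mt x /\<^sub>R norm (mt x))"

definition tangent_plane_scheme ::
  "(real ^ 'd::finite) set \<Rightarrow> ('d \<Rightarrow> real list) \<Rightarrow> real \<Rightarrow> (real ^ 'd \<Rightarrow> real ^ 3) \<Rightarrow>
   (real ^ 'd \<Rightarrow> real ^ 3) \<Rightarrow> (real ^ 'd \<Rightarrow> real ^ 3) \<Rightarrow> bool" where
  "tangent_plane_scheme \<Omega> P \<Delta>t m u m' \<longleftrightarrow>
     u \<in> tangent_space \<Omega> P m \<and>
     (\<forall>w\<in>tangent_space \<Omega> P m.
        inner_h P u w + \<Delta>t * grad_inner_h P u w + grad_inner_h P m w = 0) \<and>
     m' = nodal_interp \<Omega> P (\<lambda>x. (m x + \<Delta>t *\<^sub>R u x) /\<^sub>R norm (m x + \<Delta>t *\<^sub>R u x))"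

end

theory Submission
  imports Defs
begin

text \<open>At every node the projection step reads \<open>u = - m \<times> (m \<times> L)\<close> with \<open>L\<close> the
  discrete Laplacian of \<open>m + \<Delta>t u\<close>, because mass lumping makes \<open>inner_h\<close> a positively weighted
  nodal inner product. As \<open>|m| = 1\<close>, the right-hand side is the projection of \<open>L\<close> onto the plane
  orthogonal to \<open>m\<close>, and \<open>u\<close> equals this projection iff \<open>u\<close> is tangential and
  \<open>u\<close> and \<open>L\<close> have the same products with all tangential test functions; the latter products
  are \<open>- (\<nabla>(m + \<Delta>t u), \<nabla>w)\<close>.

  This needs finite element functions with arbitrary nodal values. They are combinations of tensor
  products of hat functions, whose membership in \<open>H1\<close> follows from translation invariance of the
  integral: difference quotients can be moved from one factor to the other, and dominated convergence
  passes to the limit.\<close>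

section \<open>Weak derivatives of Lipschitz functions\<close>

lemma test_function_continuous:
  assumes "test_function \<Omega> \<phi>"
  shows "continuous_on UNIV \<phi>" "continuous_on UNIV (partial i \<phi>)"
proof -
  from assms have "Ck 0 \<phi>" "Ck (Suc 0) \<phi>" unfolding test_function_def by blast+
  then show "continuous_on UNIV \<phi>" "continuous_on UNIV (partial i \<phi>)" by auto
qed

text \<open>The complement of the closed support is open, so near such a point \<phi> coincides with
  the zero function and shares its derivative.\<close>

lemma test_function_vanishes_outside:
  assumes "test_function \<Omega> \<phi>" "x \<notin> closure {x. \<phi> x \<noteq> 0}"
  shows "\<phi> x = 0" "partial i \<phi> x = 0"
proof -
  show "\<phi> x = 0" using assms(2) closure_subset[of "{x. \<phi> x \<noteq> 0}"] by auto
  have "((\<lambda>x. 0) has_derivative (\<lambda>h. 0)) (at x)" by simp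
  then have "(\<phi> has_derivative (\<lambda>h. 0)) (at x)"
  proof (rule has_derivative_transform_within_open)
    show "open (- closure {x. \<phi> x \<noteq> 0})" by (simp add: open_Compl)
    show "x \<in> - closure {x. \<phi> x \<noteq> 0}" using assms by simp
    fix y assume "y \<in> - closure {x. \<phi> x \<noteq> 0}"
    then show "0 = \<phi> y" using closure_subset[of "{x. \<phi> x \<noteq> 0}"] by auto
  qed
  from frechet_derivative_at[OF this] show "partial i \<phi> x = 0"
    by (simp add: partial_def fun_eq_iff)
qed

lemma test_function_bounded_support:
  assumes "test_function \<Omega> \<phi>"
  obtains R where "R \<ge> 0" "\<And>x. norm x > R \<Longrightarrow> x \<notin> closure {x. \<phi> x \<noteq> 0}"
proof -
  from assms have "bounded (closure {x. \<phi> x \<noteq> 0})"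
    unfolding test_function_def by (blast intro: compact_imp_bounded)
  then obtain R where "\<forall>x\<in>closure {x. \<phi> x \<noteq> 0}. norm x \<le> R"
    by (auto simp: bounded_iff)
  then show ?thesis by (intro that[of "max R 0"]) force+
qed

lemma compactly_supported_bounded:
  fixes \<psi> :: "'a::euclidean_space \<Rightarrow> real"
  assumes "continuous_on UNIV \<psi>" "\<And>x. norm x > R \<Longrightarrow> \<psi> x = 0"
  obtains M where "M \<ge> 0" "\<And>x. \<bar>\<psi> x\<bar> \<le> M"
proof -
  have "compact (\<psi> ` cball 0 R)"
    by (intro compact_continuous_image continuous_on_subset[OF assms(1)]) auto
  then obtain M where M: "\<forall>y\<in>\<psi> ` cball 0 R. norm y \<le> M"
    using compact_imp_bounded bounded_iff by metis
  show ?thesis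
  proof (rule that[of "max M 0"])
    fix x show "\<bar>\<psi> x\<bar> \<le> max M 0"
      using M assms(2)[of x] by (cases "norm x > R") (auto simp: le_max_iff_disj)
  qed auto
qed

lemma test_function_bounded:
  assumes "test_function \<Omega> \<phi>"
  obtains M where "M \<ge> 0" "\<And>x. \<bar>\<phi> x\<bar> \<le> M" "\<And>x. \<bar>partial i \<phi> x\<bar> \<le> M"
proof -
  obtain R where R: "\<And>x. norm x > R \<Longrightarrow> x \<notin> closure {x. \<phi> x \<noteq> 0}"
    using test_function_bounded_support[OF assms] by metis
  obtain M1 where M1: "M1 \<ge> 0" "\<And>x. \<bar>\<phi> x\<bar> \<le> M1"
    using compactly_supported_bounded[OF test_function_continuous(1)[OF assms]]
      test_function_vanishes_outside(1)[OF assms R] by metis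
  obtain M2 where M2: "\<And>x. \<bar>partial i \<phi> x\<bar> \<le> M2"
    using compactly_supported_bounded[OF test_function_continuous(2)[OF assms, of i]]
      test_function_vanishes_outside(2)[OF assms R] by metis
  show ?thesis
    by (rule that[of "max M1 M2"]) (use M1 M2 in \<open>auto simp: le_max_iff_disj\<close>)
qed

text \<open>Chain rule along an axis-parallel line. It reduces partial derivatives to derivatives of
  one real variable, to which the mean value theorem applies.\<close>

lemma test_function_line_derivative:
  assumes "test_function \<Omega> \<phi>"
  shows "((\<lambda>t. \<phi> (x + t *\<^sub>R axis i 1)) has_real_derivative
           partial i \<phi> (x + t *\<^sub>R axis i 1)) (at t)"
proof -
  have "Ck (Suc 0) \<phi>" using assms unfolding test_function_def by blast
  then have "\<phi> differentiable (at (x + t *\<^sub>R axis i 1))"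
    by (auto simp: differentiable_on_def)
  then have d: "(\<phi> has_derivative frechet_derivative \<phi> (at (x + t *\<^sub>R axis i 1)))
      (at (x + t *\<^sub>R axis i 1))"
    by (simp add: frechet_derivative_works)
  interpret linear "frechet_derivative \<phi> (at (x + t *\<^sub>R axis i 1))"
    using d by (rule has_derivative_linear)
  have "((\<lambda>t. x + t *\<^sub>R axis i 1) has_derivative (\<lambda>h. h *\<^sub>R axis i 1)) (at t)"
    by (auto intro!: derivative_eq_intros)
  from has_derivative_compose[OF this d]
  show ?thesis
    unfolding has_field_derivative_def partial_def by (rule has_derivative_eq_rhs) (simp add: scale fun_eq_iff)
qed

text \<open>Mean value theorem on the segment from \<open>x\<close> to the shifted point. Difference
  quotients are thereby bounded uniformly in the step, as dominated convergence requires.\<close>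

lemma test_function_difference_bound:
  assumes "test_function \<Omega> \<phi>" "\<And>x. \<bar>partial i \<phi> x\<bar> \<le> M" "h > 0"
  shows "\<bar>\<phi> (x + h *\<^sub>R axis i 1) - \<phi> x\<bar> \<le> M * h"
proof -
  obtain z where "\<phi> (x + h *\<^sub>R axis i 1) - \<phi> (x + 0 *\<^sub>R axis i 1) =
      (h - 0) * partial i \<phi> (x + z *\<^sub>R axis i 1)"
    using MVT2[OF \<open>h > 0\<close> test_function_line_derivative[OF assms(1)], of x i] by blast
  then have "\<bar>\<phi> (x + h *\<^sub>R axis i 1) - \<phi> x\<bar> = h * \<bar>partial i \<phi> (x + z *\<^sub>R axis i 1)\<bar>"
    using assms(3) by (simp add: abs_mult)
  also have "\<dots> \<le> h * M" using assms(2,3) by (simp add: mult_left_mono)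
  finally show ?thesis by (simp add: mult.commute)
qed

section \<open>Integration by parts through translation invariance\<close>

lemma difference_quotient_tendsto:
  fixes f :: "real \<Rightarrow> real"
  assumes "(f has_real_derivative D) (at x)"
  shows "(\<lambda>n. (f (x + inverse (real (Suc n))) - f x) * real (Suc n)) \<longlonglongrightarrow> D"
proof -
  have "(\<lambda>h. (f (x + h) - f x) / h) \<midarrow>0\<rightarrow> D"
    using assms by (simp add: DERIV_def)
  moreover have "filterlim (\<lambda>n. inverse (real (Suc n))) (at 0) sequentially"
    by (intro filterlim_atI LIMSEQ_inverse_real_of_nat) auto
  ultimately have "(\<lambda>n. (f (x + inverse (real (Suc n))) - f x) / inverse (real (Suc n))) \<longlonglongrightarrow> D"
    by (rule filterlim_compose)
  then show ?thesis by (simp add: field_simps)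
qed

lemma integral_lborel_translate:
  fixes f :: "'a::euclidean_space \<Rightarrow> real"
  assumes "f \<in> borel_measurable borel"
  shows "integral\<^sup>L lborel (\<lambda>x. f (x + c)) = integral\<^sup>L lborel f"
proof -
  have "integral\<^sup>L lborel f = integral\<^sup>L (distr lborel borel ((+) c)) f"
    by (simp add: lborel_distr_plus)
  also have "\<dots> = integral\<^sup>L lborel (\<lambda>x. f (c + x))"
    using assms by (intro integral_distr) auto
  finally show ?thesis by (simp add: add.commute)
qed

text \<open>Weak derivatives are defined by integrals over \<Omega>, whereas translation needs the
  whole space. Extension by zero does not change the integral, and completion of the measure does
  not change the integral of a Borel function.\<close>

lemma integral_lebesgue_on_eq_lborel:
  fixes f :: "'a::euclidean_space \<Rightarrow> real"
  assumes "f \<in> borel_measurable borel" "open \<Omega>" "\<And>x. x \<notin> \<Omega> \<Longrightarrow> f x = 0"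
  shows "integral\<^sup>L (lebesgue_on \<Omega>) f = integral\<^sup>L lborel f"
proof -
  have "integral\<^sup>L (lebesgue_on \<Omega>) f = integral\<^sup>L lebesgue (\<lambda>x. indicator \<Omega> x *\<^sub>R f x)"
    using assms(2) by (intro integral_restrict_space) (auto simp: borel_open)
  also have "(\<lambda>x. indicator \<Omega> x *\<^sub>R f x) = f"
    using assms(3) by (auto simp: indicator_def fun_eq_iff)
  also have "integral\<^sup>L lebesgue f = integral\<^sup>L lborel f"
    using assms(1) by (intro integral_completion) simp
  finally show ?thesis .
qed

text \<open>Discrete integration by parts: the difference quotient of the product of
  \<open>f\<close> and \<phi> integrates to zero by translation invariance and splits into a
  quotient on \<open>f\<close> and one on \<phi>. The Lipschitz bound on \<open>f\<close> and the
  bound on the derivative of \<phi> provide dominating functions for the two limits.\<close>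

lemma weak_partial_of_difference_quotient:
  fixes f g :: "real ^ 'd::finite \<Rightarrow> real"
  assumes f: "f \<in> borel_measurable borel" and fB: "\<And>x. \<bar>f x\<bar> \<le> B"
    and lip: "\<And>x h. h > 0 \<Longrightarrow> \<bar>f (x + h *\<^sub>R axis i 1) - f x\<bar> \<le> K * h"
    and g: "g \<in> borel_measurable borel"
    and lim: "AE x in lborel.
      (\<lambda>n. (f (x + inverse (real (Suc n)) *\<^sub>R axis i 1) - f x) * real (Suc n)) \<longlonglongrightarrow> g x"
    and "open \<Omega>"
  shows "weak_partial \<Omega> i f g"
  unfolding weak_partial_def
proof (intro allI impI)
  fix \<phi> assume \<phi>: "test_function \<Omega> \<phi>"
  obtain M where M: "M \<ge> 0" "\<And>x. \<bar>\<phi> x\<bar> \<le> M" "\<And>x. \<bar>partial i \<phi> x\<bar> \<le> M"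
    using test_function_bounded[OF \<phi>] by metis
  obtain R where R: "R \<ge> 0" "\<And>x. norm x > R \<Longrightarrow> x \<notin> closure {x. \<phi> x \<noteq> 0}"
    using test_function_bounded_support[OF \<phi>] by metis
  have \<phi>R: "\<phi> x = 0" if "norm x > R" for x
    using test_function_vanishes_outside(1)[OF \<phi> R(2)] that by simp
  have B: "B \<ge> 0" using fB[of undefined] by linarith
  have K: "K \<ge> 0" using lip[of 1 undefined] by linarith
  define e where "e n = inverse (real (Suc n)) *\<^sub>R (axis i 1 :: real^'d)" for n
  have e1: "norm (e n) \<le> 1" for n
    by (simp add: e_def norm_axis_1 inverse_le_1_iff)
  \<comment> \<open>The shifts have length at most 1, so a ball of radius \<open>R + 1\<close>
    contains the supports of all shifted test functions at once.\<close>
  have far: "norm (x + e n) > R" if "x \<notin> cball 0 (R + 1)" for x n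
    using norm_triangle_ineq4[of "x + e n" "e n"] e1[of n] that by simp
  \<comment> \<open>Discrete product rule: \<phi> is evaluated at the shifted point in
    \<open>D\<close>, and \<open>f\<close> at the unshifted point in \<open>E\<close>, so that mixed
    terms cancel in \<open>D n x + E n x\<close>.\<close>
  define D where "D n x = (f (x + e n) - f x) * real (Suc n) * \<phi> (x + e n)" for n x
  define E where "E n x = f x * ((\<phi> (x + e n) - \<phi> x) * real (Suc n))" for n x
  have [measurable]: "\<phi> \<in> borel_measurable borel" "partial i \<phi> \<in> borel_measurable borel"
    using test_function_continuous[OF \<phi>] by (auto intro: borel_measurable_continuous_onI)
  note [measurable] = f g
  have Kn: "\<bar>f (x + e n) - f x\<bar> * real (Suc n) \<le> K" for x n
    using lip[of "inverse (real (Suc n))" x] unfolding e_def by (simp add: field_simps)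
  have Mn: "\<bar>\<phi> (x + e n) - \<phi> x\<bar> * real (Suc n) \<le> M" for x n
    using test_function_difference_bound[OF \<phi> M(3), of "inverse (real (Suc n))" x]
    unfolding e_def by (simp add: field_simps)
  have Dbd: "norm (D n x) \<le> indicator (cball 0 (R + 1)) x * (K * M)" for n x
  proof (cases "x \<in> cball 0 (R + 1)")
    case True
    have "norm (D n x) = (\<bar>f (x + e n) - f x\<bar> * real (Suc n)) * \<bar>\<phi> (x + e n)\<bar>"
      by (simp add: D_def abs_mult)
    also have "\<dots> \<le> K * M" using Kn M K by (intro mult_mono) auto
    finally show ?thesis using True by simp
  next
    case False
    then show ?thesis using \<phi>R[OF far[OF False]] by (simp add: D_def)
  qed
  have Ebd: "norm (E n x) \<le> indicator (cball 0 (R + 1)) x * (B * M)" for n x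
  proof (cases "x \<in> cball 0 (R + 1)")
    case True
    have "norm (E n x) = \<bar>f x\<bar> * (\<bar>\<phi> (x + e n) - \<phi> x\<bar> * real (Suc n))"
      by (simp add: E_def abs_mult)
    also have "\<dots> \<le> B * M" using Mn fB B by (intro mult_mono) auto
    finally show ?thesis using True by simp
  next
    case False
    then show ?thesis using \<phi>R[OF far[OF False, of n]] \<phi>R[of x] by (simp add: E_def)
  qed
  have int: "integrable lborel (\<lambda>x::real^'d. indicator (cball 0 (R + 1)) x * c)" for c :: real
    by (intro integrable_mult_left integrable_real_indicator) (use emeasure_lborel_cball_finite in auto)
  have Dlim: "AE x in lborel. (\<lambda>n. D n x) \<longlonglongrightarrow> g x * \<phi> x"
    using lim
  proof eventually_elim
    case (elim x)
    have "(\<lambda>n. x + e n) \<longlonglongrightarrow> x + 0 *\<^sub>R axis i 1"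
      unfolding e_def by (intro tendsto_intros LIMSEQ_inverse_real_of_nat)
    then have "(\<lambda>n. \<phi> (x + e n)) \<longlonglongrightarrow> \<phi> x"
      by (intro continuous_on_tendsto_compose[OF test_function_continuous(1)[OF \<phi>]]) auto
    then show ?case using elim unfolding D_def e_def by (intro tendsto_mult)
  qed
  have Elim: "(\<lambda>n. E n x) \<longlonglongrightarrow> f x * partial i \<phi> x" for x
    using difference_quotient_tendsto[OF test_function_line_derivative[OF \<phi>, of x i 0]]
    unfolding E_def e_def by (intro tendsto_mult) auto
  have meas: "D n \<in> borel_measurable lborel" "E n \<in> borel_measurable lborel" for n
    unfolding D_def E_def by measurable
  have Dint: "integrable lborel (D n)" and Eint: "integrable lborel (E n)" for n
    by (rule Bochner_Integration.integrable_bound[OF int[of "K * M"]] Bochner_Integration.integrable_bound[OF int[of "B * M"]],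
        use meas Dbd Ebd K B M in \<open>auto simp: abs_mult\<close>)+
  have limD: "(\<lambda>n. integral\<^sup>L lborel (D n)) \<longlonglongrightarrow> integral\<^sup>L lborel (\<lambda>x. g x * \<phi> x)"
    by (rule integral_dominated_convergence[OF _ meas(1) int[of "K * M"]])
      (use Dlim Dbd in auto)
  have limE: "(\<lambda>n. integral\<^sup>L lborel (E n)) \<longlonglongrightarrow> integral\<^sup>L lborel (\<lambda>x. f x * partial i \<phi> x)"
    by (rule integral_dominated_convergence[OF _ meas(2) int[of "B * M"]])
      (use Elim Ebd in auto)
  have DE: "integral\<^sup>L lborel (D n) + integral\<^sup>L lborel (E n) = 0" for n
  proof -
    have f\<phi>: "integrable lborel (\<lambda>x. f x * \<phi> x)"
    proof (rule Bochner_Integration.integrable_bound[OF int[of "B * M"]])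
      show "AE x in lborel. norm (f x * \<phi> x) \<le> norm (indicator (cball 0 (R + 1)) x * (B * M))"
      proof (intro AE_I2)
        fix x :: "real^'d"
        show "norm (f x * \<phi> x) \<le> norm (indicator (cball 0 (R + 1)) x * (B * M))"
        proof (cases "norm x > R")
          case False
          have "\<bar>f x\<bar> * \<bar>\<phi> x\<bar> \<le> B * M" using fB M B by (intro mult_mono) auto
          then show ?thesis using False B M(1) by (simp add: abs_mult)
        qed (simp add: \<phi>R)
      qed
    qed measurable
    have shift: "integral\<^sup>L lborel (\<lambda>x. f (x + e n) * \<phi> (x + e n)) =
        integral\<^sup>L lborel (\<lambda>x. f x * \<phi> x)"
      by (rule integral_lborel_translate[of "\<lambda>x. f x * \<phi> x"]) measurable
    have sum: "D n x + E n x = real (Suc n) * (f (x + e n) * \<phi> (x + e n) - f x * \<phi> x)" for x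
      by (simp add: D_def E_def algebra_simps)
    \<comment> \<open>Solving the identity \<open>sum\<close> for the shifted product gives its
      integrability, which is needed to split the integral of the difference.\<close>
    have "integrable lborel (\<lambda>x. inverse (real (Suc n)) * (D n x + E n x) + f x * \<phi> x)"
      using Dint Eint f\<phi> by simp
    moreover have "inverse (real (Suc n)) * (D n x + E n x) + f x * \<phi> x =
        f (x + e n) * \<phi> (x + e n)" for x
      unfolding sum mult.assoc[symmetric] by (subst left_inverse) simp_all
    ultimately have f\<phi>': "integrable lborel (\<lambda>x. f (x + e n) * \<phi> (x + e n))"
      by simp
    have "integral\<^sup>L lborel (D n) + integral\<^sup>L lborel (E n) = integral\<^sup>L lborel (\<lambda>x. D n x + E n x)"
      using Dint Eint by simp
    also have "\<dots> = real (Suc n) * integral\<^sup>L lborel (\<lambda>x. f (x + e n) * \<phi> (x + e n) - f x * \<phi> x)"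
      by (simp only: sum integral_mult_right_zero)
    also have "\<dots> = 0" using f\<phi> f\<phi>' shift by simp
    finally show ?thesis .
  qed
  have "(\<lambda>n. 0) \<longlonglongrightarrow>
      integral\<^sup>L lborel (\<lambda>x. g x * \<phi> x) + integral\<^sup>L lborel (\<lambda>x. f x * partial i \<phi> x)"
    using tendsto_add[OF limD limE] unfolding DE .
  then have "integral\<^sup>L lborel (\<lambda>x. g x * \<phi> x) + integral\<^sup>L lborel (\<lambda>x. f x * partial i \<phi> x) = 0"
    by (simp add: LIMSEQ_const_iff)
  moreover have out: "x \<notin> closure {x. \<phi> x \<noteq> 0}" if "x \<notin> \<Omega>" for x
    using \<phi> that unfolding test_function_def by blast
  have "integral\<^sup>L (lebesgue_on \<Omega>) (\<lambda>x. f x * partial i \<phi> x) = integral\<^sup>L lborel (\<lambda>x. f x * partial i \<phi> x)"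
    using \<open>open \<Omega>\<close> by (rule integral_lebesgue_on_eq_lborel[rotated])
      (simp_all add: test_function_vanishes_outside(2)[OF \<phi> out])
  moreover have "integral\<^sup>L (lebesgue_on \<Omega>) (\<lambda>x. g x * \<phi> x) = integral\<^sup>L lborel (\<lambda>x. g x * \<phi> x)"
    using \<open>open \<Omega>\<close> by (rule integral_lebesgue_on_eq_lborel[rotated])
      (simp_all add: test_function_vanishes_outside(1)[OF \<phi> out])
  ultimately show "integral\<^sup>L (lebesgue_on \<Omega>) (\<lambda>x. f x * partial i \<phi> x) =
        - integral\<^sup>L (lebesgue_on \<Omega>) (\<lambda>x. g x * \<phi> x)"
    by linarith
qed

section \<open>Linear structure of \<open>L2\<close> and \<open>H1\<close>\<close>

lemma L2_add:
  assumes "f \<in> L2 \<Omega>" "g \<in> L2 \<Omega>"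
  shows "(\<lambda>x. f x + g x) \<in> L2 \<Omega>"
proof -
  have m[measurable]: "f \<in> borel_measurable (lebesgue_on \<Omega>)" "g \<in> borel_measurable (lebesgue_on \<Omega>)"
    and i: "integrable (lebesgue_on \<Omega>) (\<lambda>x. 2 * (f x)\<^sup>2 + 2 * (g x)\<^sup>2)"
    using assms by (auto simp: L2_def)
  have "(f x + g x)\<^sup>2 \<le> 2 * (f x)\<^sup>2 + 2 * (g x)\<^sup>2" for x
    using sum_squares_bound[of "f x" "g x"] by (simp add: power2_sum)
  then have "integrable (lebesgue_on \<Omega>) (\<lambda>x. (f x + g x)\<^sup>2)"
    by (intro Bochner_Integration.integrable_bound[OF i]) auto
  then show ?thesis by (simp add: L2_def)
qed

lemma L2_scale:
  assumes "f \<in> L2 \<Omega>"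
  shows "(\<lambda>x. c * f x) \<in> L2 \<Omega>"
  using assms by (auto simp: L2_def power_mult_distrib)

lemma L2_of_bounded:
  fixes f :: "real ^ 'd::finite \<Rightarrow> real"
  assumes "f \<in> borel_measurable borel" "\<And>x. \<bar>f x\<bar> \<le> B"
  shows "f \<in> L2 (box a b)"
proof -
  have "finite_measure (lebesgue_on (box a b))"
    by (intro finite_measure_lebesgue_on) simp
  then interpret finite_measure "lebesgue_on (box a b)" .
  have m[measurable]: "f \<in> borel_measurable (lebesgue_on (box a b))"
    using assms(1) by (intro measurable_restrict_space1 measurable_completion) simp
  have "\<bar>f x\<bar>\<^sup>2 \<le> B\<^sup>2" for x using assms(2) by (intro power_mono) auto
  then have "integrable (lebesgue_on (box a b)) (\<lambda>x. (f x)\<^sup>2)"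
    by (intro integrable_const_bound[where B = "B\<^sup>2"]) auto
  then show ?thesis using m by (simp add: L2_def)
qed

text \<open>The product is dominated by the sum of the two squares. Both are integrable, as a
  bounded Borel function is square integrable on a box.\<close>

lemma L2_mult_bounded_integrable:
  assumes "f \<in> L2 (box a b)" "\<psi> \<in> borel_measurable borel" "\<And>x. \<bar>\<psi> x\<bar> \<le> M"
  shows "integrable (lebesgue_on (box a b)) (\<lambda>x. f x * \<psi> x)"
proof -
  have [measurable]: "f \<in> borel_measurable (lebesgue_on (box a b))"
    and i: "integrable (lebesgue_on (box a b)) (\<lambda>x. (f x)\<^sup>2)"
    using assms(1) by (auto simp: L2_def)
  have [measurable]: "\<psi> \<in> borel_measurable (lebesgue_on (box a b))"
    using assms(2) by (intro measurable_restrict_space1 measurable_completion) simp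
  have "(\<lambda>x. \<psi> x) \<in> L2 (box a b)" using assms(2,3) by (rule L2_of_bounded)
  then have "integrable (lebesgue_on (box a b)) (\<lambda>x. (f x)\<^sup>2 + (\<psi> x)\<^sup>2)"
    using i by (simp add: L2_def)
  moreover have "\<bar>f x * \<psi> x\<bar> \<le> (f x)\<^sup>2 + (\<psi> x)\<^sup>2" for x
  proof -
    have "2 * (\<bar>f x\<bar> * \<bar>\<psi> x\<bar>) \<le> (f x)\<^sup>2 + (\<psi> x)\<^sup>2"
      using sum_squares_bound[of "\<bar>f x\<bar>" "\<bar>\<psi> x\<bar>"] by (simp add: mult.assoc)
    moreover have "0 \<le> \<bar>f x\<bar> * \<bar>\<psi> x\<bar>" by simp
    ultimately show ?thesis unfolding abs_mult by linarith
  qed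
  ultimately show ?thesis by (elim Bochner_Integration.integrable_bound) auto
qed

lemma test_function_L2_integrable:
  assumes "test_function \<Omega> \<phi>" "f \<in> L2 (box a b)"
  shows "integrable (lebesgue_on (box a b)) (\<lambda>x. f x * \<phi> x)"
    "integrable (lebesgue_on (box a b)) (\<lambda>x. f x * partial i \<phi> x)"
proof -
  obtain M where "\<And>x. \<bar>\<phi> x\<bar> \<le> M" "\<And>x. \<bar>partial i \<phi> x\<bar> \<le> M"
    using test_function_bounded[OF assms(1)] by metis
  then show "integrable (lebesgue_on (box a b)) (\<lambda>x. f x * \<phi> x)"
    "integrable (lebesgue_on (box a b)) (\<lambda>x. f x * partial i \<phi> x)"
    using test_function_continuous[OF assms(1)]
    by (auto intro!: L2_mult_bounded_integrable[OF assms(2)] borel_measurable_continuous_onI)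
qed

text \<open>The integral of a sum splits when both summands are integrable; membership of the
  functions and their derivatives in \<open>L2\<close> ensures this for the products with \<phi> and
  its partial derivative.\<close>

lemma weak_partial_add:
  assumes "weak_partial (box a b) i f1 g1" "weak_partial (box a b) i f2 g2"
    "f1 \<in> L2 (box a b)" "g1 \<in> L2 (box a b)" "f2 \<in> L2 (box a b)" "g2 \<in> L2 (box a b)"
  shows "weak_partial (box a b) i (\<lambda>x. f1 x + f2 x) (\<lambda>x. g1 x + g2 x)"
  unfolding weak_partial_def
proof (intro allI impI)
  fix \<phi> assume \<phi>: "test_function (box a b) \<phi>"
  note int = test_function_L2_integrable[OF \<phi>]
  show "integral\<^sup>L (lebesgue_on (box a b)) (\<lambda>x. (f1 x + f2 x) * partial i \<phi> x) =
        - integral\<^sup>L (lebesgue_on (box a b)) (\<lambda>x. (g1 x + g2 x) * \<phi> x)"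
    using assms(1,2) \<phi> int[OF assms(3)] int[OF assms(4)] int[OF assms(5)] int[OF assms(6)]
    by (simp add: weak_partial_def distrib_right)
qed

lemma weak_partial_scale:
  assumes "weak_partial \<Omega> i f g"
  shows "weak_partial \<Omega> i (\<lambda>x. c * f x) (\<lambda>x. c * g x)"
  using assms by (simp add: weak_partial_def mult.assoc)

lemma H1_add:
  assumes "f \<in> H1 (box a b)" "g \<in> H1 (box a b)"
  shows "(\<lambda>x. f x + g x) \<in> H1 (box a b)"
  unfolding H1_def
proof (intro CollectI conjI allI)
  show "(\<lambda>x. f x + g x) \<in> L2 (box a b)" using assms by (auto simp: H1_def intro: L2_add)
  fix i
  obtain f' g' where "f' \<in> L2 (box a b)" "weak_partial (box a b) i f f'"
    "g' \<in> L2 (box a b)" "weak_partial (box a b) i g g'"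
    using assms by (auto simp: H1_def) metis
  then show "\<exists>h\<in>L2 (box a b). weak_partial (box a b) i (\<lambda>x. f x + g x) h"
    using assms by (intro bexI[of _ "\<lambda>x. f' x + g' x"] weak_partial_add L2_add) (auto simp: H1_def)
qed

lemma H1_scale:
  assumes "f \<in> H1 \<Omega>"
  shows "(\<lambda>x. c * f x) \<in> H1 \<Omega>"
  unfolding H1_def
proof (intro CollectI conjI allI)
  show "(\<lambda>x. c * f x) \<in> L2 \<Omega>" using assms by (auto simp: H1_def intro: L2_scale)
  fix i
  obtain f' where "f' \<in> L2 \<Omega>" "weak_partial \<Omega> i f f'"
    using assms by (auto simp: H1_def)
  then show "\<exists>h\<in>L2 \<Omega>. weak_partial \<Omega> i (\<lambda>x. c * f x) h"
    by (intro bexI[of _ "\<lambda>x. c * f' x"] weak_partial_scale L2_scale)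
qed

text \<open>Measurability and all integrals refer to a measure whose space is \<Omega>, so values
  elsewhere do not enter. This permits cutting basis functions off outside the closed
  domain.\<close>

lemma H1_cong:
  assumes "f \<in> H1 \<Omega>" "\<And>x. x \<in> \<Omega> \<Longrightarrow> f x = g x"
  shows "g \<in> H1 \<Omega>"
proof -
  have sp: "space (lebesgue_on \<Omega>) = \<Omega>" by (simp add: space_restrict_space)
  have "g \<in> L2 \<Omega>" if "f \<in> L2 \<Omega>"
    using that assms(2)
      measurable_cong[of "lebesgue_on \<Omega>" f g borel]
      Bochner_Integration.integrable_cong[of "lebesgue_on \<Omega>" "lebesgue_on \<Omega>" "\<lambda>x. (f x)\<^sup>2" "\<lambda>x. (g x)\<^sup>2"]
    by (auto simp: L2_def sp)
  moreover have "weak_partial \<Omega> i g h" if "weak_partial \<Omega> i f h" for i h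
  proof -
    have "integral\<^sup>L (lebesgue_on \<Omega>) (\<lambda>x. f x * q x) = integral\<^sup>L (lebesgue_on \<Omega>) (\<lambda>x. g x * q x)" for q
      using assms(2) by (intro Bochner_Integration.integral_cong) (auto simp: sp)
    then show ?thesis using that by (simp add: weak_partial_def)
  qed
  ultimately show ?thesis using assms(1) unfolding H1_def by blast
qed

section \<open>Tensor products of hat functions\<close>

text \<open>For \<open>l < c < r\<close> this is the piecewise linear hat with peak 1 at
  \<open>c\<close> and support from \<open>l\<close> to \<open>r\<close>. Writing it with
  \<open>max\<close> and \<open>min\<close> leaves measurability and the Lipschitz bound free of
  case distinctions.\<close>

definition hat :: "real \<Rightarrow> real \<Rightarrow> real \<Rightarrow> real \<Rightarrow> real" where
  "hat l c r x = max 0 (min ((x - l) / (c - l)) ((r - x) / (r - c)))"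

text \<open>The derivative of the hat away from its kinks; the value 0 at the kinks is a convention
  on a null set.\<close>

definition hat_slope :: "real \<Rightarrow> real \<Rightarrow> real \<Rightarrow> real \<Rightarrow> real" where
  "hat_slope l c r x =
     (if l < x \<and> x < c then 1 / (c - l) else if c < x \<and> x < r then - 1 / (r - c) else 0)"

text \<open>Outside the support one ramp is nonpositive, so \<open>max\<close> returns 0. On either
  side of the peak the opposite ramp is at least 1 and \<open>min\<close> selects the ramp of that
  side.\<close>

lemma hat_eq:
  assumes "l < c" "c < r"
  shows "x \<le> l \<or> r \<le> x \<Longrightarrow> hat l c r x = 0"
    "l \<le> x \<Longrightarrow> x \<le> c \<Longrightarrow> hat l c r x = (x - l) / (c - l)"
    "c \<le> x \<Longrightarrow> x \<le> r \<Longrightarrow> hat l c r x = (r - x) / (r - c)"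
proof -
  show "hat l c r x = 0" if "x \<le> l \<or> r \<le> x"
  proof -
    have "(x - l) / (c - l) \<le> 0 \<or> (r - x) / (r - c) \<le> 0"
      using that assms by (auto simp: divide_le_0_iff)
    then show ?thesis unfolding hat_def by linarith
  qed
  show "hat l c r x = (x - l) / (c - l)" if "l \<le> x" "x \<le> c"
  proof -
    have "0 \<le> (x - l) / (c - l)" "(x - l) / (c - l) \<le> 1" "1 \<le> (r - x) / (r - c)"
      using that assms by simp_all
    then show ?thesis unfolding hat_def by linarith
  qed
  show "hat l c r x = (r - x) / (r - c)" if "c \<le> x" "x \<le> r"
  proof -
    have "0 \<le> (r - x) / (r - c)" "(r - x) / (r - c) \<le> 1" "1 \<le> (x - l) / (c - l)"
      using that assms by simp_all
    then show ?thesis unfolding hat_def by linarith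
  qed
qed

lemma hat_center: "l < c \<Longrightarrow> c < r \<Longrightarrow> hat l c r c = 1"
  by (simp add: hat_eq)

lemma hat_range:
  assumes "l < c" "c < r"
  shows "0 \<le> hat l c r x" "hat l c r x \<le> 1"
proof -
  show "0 \<le> hat l c r x" by (simp add: hat_def)
  have "(x - l) / (c - l) \<le> 1 \<or> (r - x) / (r - c) \<le> 1" using assms by auto
  then show "hat l c r x \<le> 1" unfolding hat_def by linarith
qed

text \<open>A shift by \<open>h\<close> changes each ramp by \<open>h\<close> times its slope, and
  \<open>min\<close> and \<open>max\<close> do not amplify changes. The sum of the two slopes is a
  convenient upper bound.\<close>

lemma hat_difference_bound:
  assumes "l < c" "c < r" "h > 0"
  shows "\<bar>hat l c r (x + h) - hat l c r x\<bar> \<le> (1 / (c - l) + 1 / (r - c)) * h"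
proof -
  have "(x + h - l) / (c - l) = (x - l) / (c - l) + h / (c - l)"
    "(r - (x + h)) / (r - c) = (r - x) / (r - c) - h / (r - c)"
    by (simp_all add: add_divide_distrib diff_divide_distrib)
  moreover have "h / (c - l) \<ge> 0" "h / (r - c) \<ge> 0" using assms by simp_all
  ultimately have "\<bar>hat l c r (x + h) - hat l c r x\<bar> \<le> h / (c - l) + h / (r - c)"
    unfolding hat_def by linarith
  then show ?thesis by (simp add: distrib_right)
qed

lemma hat_slope_bound:
  assumes "l < c" "c < r"
  shows "\<bar>hat_slope l c r x\<bar> \<le> 1 / (c - l) + 1 / (r - c)"
  using assms by (auto simp: hat_slope_def)

lemma hat_has_derivative:
  assumes "l < c" "c < r" "x \<noteq> l" "x \<noteq> c" "x \<noteq> r"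
  shows "(hat l c r has_real_derivative hat_slope l c r x) (at x)"
proof -
  note tr = has_field_derivative_transform_within_open
  consider "x < l" | "l < x" "x < c" | "c < x" "x < r" | "r < x" using assms by linarith
  then show ?thesis
  proof cases
    case 1
    have "((\<lambda>x. 0) has_real_derivative hat_slope l c r x) (at x)"
      using 1 assms by (simp add: hat_slope_def)
    then show ?thesis by (rule tr[of _ _ _ "{..<l}"]) (use 1 assms in \<open>auto simp: hat_eq\<close>)
  next
    case 2
    have "((\<lambda>x. (x - l) / (c - l)) has_real_derivative hat_slope l c r x) (at x)"
      using 2 assms by (auto simp: hat_slope_def intro!: derivative_eq_intros)
    then show ?thesis by (rule tr[of _ _ _ "{l<..<c}"]) (use 2 assms in \<open>auto simp: hat_eq\<close>)
  next
    case 3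
    have "((\<lambda>x. (r - x) / (r - c)) has_real_derivative hat_slope l c r x) (at x)"
      using 3 assms by (auto simp: hat_slope_def divide_simps intro!: derivative_eq_intros)
    then show ?thesis by (rule tr[of _ _ _ "{c<..<r}"]) (use 3 assms in \<open>auto simp: hat_eq\<close>)
  next
    case 4
    have "((\<lambda>x. 0) has_real_derivative hat_slope l c r x) (at x)"
      using 4 assms by (simp add: hat_slope_def)
    then show ?thesis by (rule tr[of _ _ _ "{r<..}"]) (use 4 assms in \<open>auto simp: hat_eq\<close>)
  qed
qed

text \<open>If no kink lies strictly between \<open>s\<close> and \<open>t\<close>, one branch of
  the hat is valid on the whole interval. This makes hats polynomial on mesh cells.\<close>

lemma hat_affine_on_interval:
  assumes "l < c" "c < r"
    and "\<And>p. p \<in> {l, c, r} \<Longrightarrow> p \<le> s \<or> t \<le> p"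
  obtains \<alpha> \<beta> where "\<And>x. s \<le> x \<Longrightarrow> x \<le> t \<Longrightarrow> hat l c r x = \<alpha> + \<beta> * x"
proof -
  have split: "(x - l) / (c - l) = - l / (c - l) + 1 / (c - l) * x"
    "(r - x) / (r - c) = r / (r - c) + (- 1 / (r - c)) * x" for x
    by (simp_all add: diff_divide_distrib)
  have "t \<le> l \<or> (l \<le> s \<and> t \<le> c) \<or> (c \<le> s \<and> t \<le> r) \<or> r \<le> s"
    using assms by auto
  then consider "t \<le> l" | "l \<le> s" "t \<le> c" | "c \<le> s" "t \<le> r" | "r \<le> s" by blast
  then show ?thesis
  proof cases
    case 1
    then show ?thesis using assms by (intro that[of 0 0]) (simp add: hat_eq)
  next
    case 2
    then show ?thesis using assms
      by (intro that[of "- l / (c - l)" "1 / (c - l)"], subst split(1)[symmetric]) (simp add: hat_eq)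
  next
    case 3
    then show ?thesis using assms
      by (intro that[of "r / (r - c)" "- 1 / (r - c)"], subst split(2)[symmetric]) (simp add: hat_eq)
  next
    case 4
    then show ?thesis using assms by (intro that[of 0 0]) (simp add: hat_eq)
  qed
qed

lemma AE_lborel_coord_neq: "AE x in lborel. (x :: real ^ 'd::finite) $ i \<noteq> c"
proof -
  have "negligible {x :: real^'d. x $ i = c}"
    using negligible_standard_hyperplane[of "axis i 1 :: real^'d" c]
    by (simp add: cart_eq_inner_axis axis_in_Basis_iff)
  then have "{x :: real^'d. x $ i = c} \<in> null_sets lebesgue" by (simp add: negligible_iff_null_sets)
  then have "AE x in lebesgue. (x :: real ^ 'd) $ i \<noteq> c"
    by (rule AE_I'[where N = "{x. x $ i = c}"]) auto
  then show ?thesis by (simp add: AE_completion_iff)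
qed

text \<open>Only the factor with index \<open>i\<close> changes under a shift in direction
  \<open>i\<close>, and the other factors stay in the unit interval. The Lipschitz bound and the
  almost everywhere limit are thus inherited from a single hat; the exceptional points lie on three
  hyperplanes.\<close>

lemma tensor_hat_H1:
  fixes l c r :: "'d::finite \<Rightarrow> real"
  assumes lc: "\<And>i. l i < c i" and cr: "\<And>i. c i < r i"
  shows "(\<lambda>x :: real ^ 'd. \<Prod>i\<in>UNIV. hat (l i) (c i) (r i) (x $ i)) \<in> H1 (box a b)"
proof -
  define H where "H j x = hat (l j) (c j) (r j) (x $ j)" for j and x :: "real^'d"
  define S where "S j x = hat_slope (l j) (c j) (r j) (x $ j)" for j and x :: "real^'d"
  have Hm[measurable]: "H j \<in> borel_measurable borel" for j
    unfolding H_def hat_def by measurable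
  have Sm[measurable]: "S j \<in> borel_measurable borel" for j
    unfolding S_def hat_slope_def by measurable
  have H01: "0 \<le> H j x" "H j x \<le> 1" for j x
    unfolding H_def using hat_range[OF lc cr] by auto
  have bd: "\<bar>\<Prod>j\<in>A. H j x\<bar> \<le> 1" for A x
    using H01 by (simp add: abs_prod prod_le_1)
  have other: "H j (x + h *\<^sub>R axis i 1) = H j x" if "j \<noteq> i" for i j x h
    using that by (simp add: H_def axis_def)
  have split: "(\<Prod>j\<in>UNIV. H j x) = H i x * (\<Prod>j\<in>UNIV - {i}. H j x)" for i x
    by (simp add: prod.remove)
  have diff: "(\<Prod>j\<in>UNIV. H j (x + h *\<^sub>R axis i 1)) - (\<Prod>j\<in>UNIV. H j x) =
      (H i (x + h *\<^sub>R axis i 1) - H i x) * (\<Prod>j\<in>UNIV - {i}. H j x)" for x h i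
  proof -
    have "(\<Prod>j\<in>UNIV - {i}. H j (x + h *\<^sub>R axis i 1)) = (\<Prod>j\<in>UNIV - {i}. H j x)"
      by (intro prod.cong) (auto simp: other)
    then show ?thesis by (simp add: split[of _ i] left_diff_distrib)
  qed
  have coord: "(x + h *\<^sub>R axis i 1) $ i = x $ i + h" for x :: "real^'d" and h i
    by (simp add: axis_def)
  have "\<exists>g\<in>L2 (box a b). weak_partial (box a b) i (\<lambda>x. \<Prod>j\<in>UNIV. H j x) g" for i
  proof
    let ?g = "\<lambda>x. S i x * (\<Prod>j\<in>UNIV - {i}. H j x)"
    let ?K = "1 / (c i - l i) + 1 / (r i - c i)"
    have K: "?K \<ge> 0" using lc[of i] cr[of i] by simp
    show "?g \<in> L2 (box a b)"
    proof (rule L2_of_bounded)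
      fix x
      show "\<bar>?g x\<bar> \<le> ?K * 1"
        unfolding abs_mult using bd K hat_slope_bound[OF lc cr]
        by (intro mult_mono) (auto simp: S_def)
    qed measurable
    show "weak_partial (box a b) i (\<lambda>x. \<Prod>j\<in>UNIV. H j x) ?g"
    proof (rule weak_partial_of_difference_quotient)
      fix x :: "real^'d" and h :: real assume "h > 0"
      have "\<bar>H i (x + h *\<^sub>R axis i 1) - H i x\<bar> \<le> ?K * h"
        unfolding H_def coord by (rule hat_difference_bound[OF lc cr \<open>h > 0\<close>])
      then have "\<bar>H i (x + h *\<^sub>R axis i 1) - H i x\<bar> * \<bar>\<Prod>j\<in>UNIV - {i}. H j x\<bar> \<le> (?K * h) * 1"
        using K \<open>h > 0\<close> bd by (intro mult_mono) auto
      then show "\<bar>(\<Prod>j\<in>UNIV. H j (x + h *\<^sub>R axis i 1)) - (\<Prod>j\<in>UNIV. H j x)\<bar> \<le> ?K * h"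
        by (simp add: diff abs_mult)
    next
      show "AE x in lborel. (\<lambda>n. ((\<Prod>j\<in>UNIV. H j (x + inverse (real (Suc n)) *\<^sub>R axis i 1)) -
          (\<Prod>j\<in>UNIV. H j x)) * real (Suc n)) \<longlonglongrightarrow> ?g x"
        using AE_lborel_coord_neq[of i "l i"] AE_lborel_coord_neq[of i "c i"]
          AE_lborel_coord_neq[of i "r i"]
      proof eventually_elim
        case (elim x)
        have "(\<lambda>n. (H i (x + inverse (real (Suc n)) *\<^sub>R axis i 1) - H i x) * real (Suc n)) \<longlonglongrightarrow> S i x"
          unfolding H_def S_def coord
          by (rule difference_quotient_tendsto[OF hat_has_derivative[OF lc cr elim]])
        from tendsto_mult[OF this tendsto_const[of "\<Prod>j\<in>UNIV - {i}. H j x"]]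
        show ?case unfolding diff by (simp only: mult_ac)
      qed
    qed (use bd in auto)
  qed
  moreover have "(\<lambda>x. \<Prod>j\<in>UNIV. H j x) \<in> L2 (box a b)"
    using bd by (intro L2_of_bounded) auto
  ultimately show ?thesis by (simp add: H1_def H_def)
qed

section \<open>Multi-affine polynomials\<close>

lemma Q1_add:
  assumes "p \<in> Q1" "q \<in> Q1"
  shows "(\<lambda>x. p x + q x) \<in> Q1"
proof -
  obtain c d where "\<And>x. p x = (\<Sum>S\<in>UNIV. c S * (\<Prod>i\<in>S. x $ i))"
    "\<And>x. q x = (\<Sum>S\<in>UNIV. d S * (\<Prod>i\<in>S. x $ i))"
    using assms by (auto simp: Q1_def)
  then show ?thesis
    unfolding Q1_def by (auto simp: distrib_right sum.distrib intro!: exI[of _ "\<lambda>S. c S + d S"])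
qed

lemma Q1_scale:
  assumes "p \<in> Q1"
  shows "(\<lambda>x. k * p x) \<in> Q1"
proof -
  obtain c where "\<And>x. p x = (\<Sum>S\<in>UNIV. c S * (\<Prod>i\<in>S. x $ i))"
    using assms by (auto simp: Q1_def)
  then show ?thesis
    unfolding Q1_def by (auto simp: sum_distrib_left mult.assoc intro!: exI[of _ "\<lambda>S. k * c S"])
qed

text \<open>Expanding the product, \<open>S\<close> is the set of factors that contribute their
  linear term; the other factors contribute their constants.\<close>

lemma Q1_prod_affine:
  "(\<lambda>x :: real ^ 'd::finite. \<Prod>i\<in>UNIV. \<alpha> i + \<beta> i * x $ i) \<in> Q1"
proof -
  have "(\<Prod>i\<in>UNIV. \<alpha> i + \<beta> i * x $ i) =
      (\<Sum>S\<in>UNIV. ((\<Prod>i\<in>S. \<beta> i) * (\<Prod>i\<in>UNIV - S. \<alpha> i)) * (\<Prod>i\<in>S. x $ i))" for x :: "real^'d"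
    using prod_add[of UNIV "\<lambda>i. \<beta> i * x $ i" \<alpha>]
    by (simp add: add.commute prod.distrib mult_ac)
  then show ?thesis
    unfolding Q1_def by (intro CollectI exI[of _ "\<lambda>S. (\<Prod>i\<in>S. \<beta> i) * (\<Prod>i\<in>UNIV - S. \<alpha> i)"] allI)
qed

lemma Q1_differentiable:
  fixes p :: "real ^ 'd::finite \<Rightarrow> real"
  assumes "p \<in> Q1"
  shows "p differentiable (at x within A)"
proof -
  obtain c where c: "p = (\<lambda>x. \<Sum>S\<in>UNIV. c S * (\<Prod>i\<in>S. x $ i))"
    using assms by (auto simp: Q1_def fun_eq_iff)
  have coord: "(\<lambda>x :: real^'d. x $ i) differentiable (at x within A)" for i
    by (intro bounded_linear_imp_differentiable bounded_linear_vec_nth)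
  have "(\<lambda>x :: real^'d. \<Prod>i\<in>S. x $ i) differentiable (at x within A)" for S
    by (induction S rule: infinite_finite_induct) (auto intro: differentiable_mult coord)
  then show ?thesis unfolding c by (intro differentiable_sum differentiable_mult) auto
qed

text \<open>Each coordinate occurs at most once in a monomial: \<alpha> collects the monomials
  without \<open>i\<close>, and \<beta> the cofactors of the coordinate in those with
  \<open>i\<close>.\<close>

lemma Q1_affine_along_axis:
  fixes p :: "real ^ 'd::finite \<Rightarrow> real"
  assumes "p \<in> Q1"
  obtains \<alpha> \<beta> where "\<And>t. p (\<chi> j. if j = i then t else x $ j) = \<alpha> + \<beta> * t"
proof -
  obtain c where c: "p = (\<lambda>x. \<Sum>S\<in>UNIV. c S * (\<Prod>i\<in>S. x $ i))"
    using assms by (auto simp: Q1_def fun_eq_iff)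
  define \<alpha> where "\<alpha> S = (if i \<in> S then 0 else c S * (\<Prod>j\<in>S. x $ j))" for S
  define \<beta> where "\<beta> S = (if i \<in> S then c S * (\<Prod>j\<in>S - {i}. x $ j) else 0)" for S
  have "c S * (\<Prod>j\<in>S. (\<chi> j. if j = i then t else x $ j) $ j) = \<alpha> S + \<beta> S * t" for S t
  proof (cases "i \<in> S")
    case True
    have "(\<Prod>j\<in>S. (\<chi> j. if j = i then t else x $ j) $ j) =
        t * (\<Prod>j\<in>S - {i}. (\<chi> j. if j = i then t else x $ j) $ j)"
      using True by (subst prod.remove[of S i]) auto
    also have "\<dots> = t * (\<Prod>j\<in>S - {i}. x $ j)"
      by (intro arg_cong2[of _ _ _ _ "(*)"] refl prod.cong) auto
    finally show ?thesis using True by (simp add: \<alpha>_def \<beta>_def)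
  next
    case False
    then have "(\<Prod>j\<in>S. (\<chi> j. if j = i then t else x $ j) $ j) = (\<Prod>j\<in>S. x $ j)"
      by (intro prod.cong) auto
    then show ?thesis using False by (simp add: \<alpha>_def \<beta>_def)
  qed
  then have "p (\<chi> j. if j = i then t else x $ j) = (\<Sum>S\<in>UNIV. \<alpha> S) + (\<Sum>S\<in>UNIV. \<beta> S) * t" for t
    unfolding c by (simp add: sum.distrib sum_distrib_right)
  then show ?thesis by (rule that)
qed

text \<open>Unisolvence of multi-affine polynomials on a nondegenerate box. Coordinates are freed
  one at a time, since an affine function of one variable with two distinct zeros vanishes.\<close>

lemma Q1_eq_0_if_0_at_vertices:
  fixes p :: "real ^ 'd::finite \<Rightarrow> real"
  assumes p: "p \<in> Q1" and st: "\<And>i. s i < t i"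
    and v: "\<And>z. (\<And>i. z $ i = s i \<or> z $ i = t i) \<Longrightarrow> p z = 0"
  shows "p x = 0"
proof -
  \<comment> \<open>\<open>A\<close> holds the coordinates already freed; all others are still
    restricted to the two vertex values.\<close>
  have "\<forall>x. (\<forall>i. i \<notin> A \<longrightarrow> x $ i = s i \<or> x $ i = t i) \<longrightarrow> p x = 0" if "finite A" for A
    using that
  proof induction
    case empty
    then show ?case using v by auto
  next
    case (insert i A)
    show ?case
    proof (intro allI impI)
      fix x :: "real^'d"
      assume x: "\<forall>j. j \<notin> insert i A \<longrightarrow> x $ j = s j \<or> x $ j = t j"
      obtain \<alpha> \<beta> where ab: "\<And>\<tau>. p (\<chi> j. if j = i then \<tau> else x $ j) = \<alpha> + \<beta> * \<tau>"
        using Q1_affine_along_axis[OF p] by metis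
      have "p (\<chi> j. if j = i then s i else x $ j) = 0" "p (\<chi> j. if j = i then t i else x $ j) = 0"
        using insert.IH x by auto
      then have "\<alpha> + \<beta> * s i = 0" "\<alpha> + \<beta> * t i = 0" by (simp_all add: ab)
      then have "\<beta> * (t i - s i) = 0" unfolding right_diff_distrib by linarith
      then have "\<beta> = 0" using st[of i] by simp
      moreover have "\<alpha> = 0" using \<open>\<alpha> + \<beta> * s i = 0\<close> \<open>\<beta> = 0\<close> by simp
      ultimately have "p (\<chi> j. if j = i then x $ i else x $ j) = 0" by (simp add: ab)
      moreover have "(\<chi> j. if j = i then x $ i else x $ j) = x" by (simp add: vec_eq_iff)
      ultimately show "p x = 0" by simp
    qed
  qed
  from this[of UNIV] show ?thesis by simp
qed

text \<open>\<open>jacobian\<close> rests on a choice of derivative. Within a nondegenerate closed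
  box the derivative is unique even at the boundary, so this choice respects sums and
  multiples.\<close>

lemma jacobian_add_scale_cbox:
  fixes f g :: "real ^ 'd::finite \<Rightarrow> real ^ 'n::finite"
  assumes "\<And>\<beta>. \<beta> \<in> Basis \<Longrightarrow> s \<bullet> \<beta> < t \<bullet> \<beta>" "z \<in> cbox s t"
    and "f differentiable (at z within cbox s t)" "g differentiable (at z within cbox s t)"
  shows "jacobian (\<lambda>x. f x + g x) (at z within cbox s t) =
      jacobian f (at z within cbox s t) + jacobian g (at z within cbox s t)"
    and "jacobian (\<lambda>x. k *\<^sub>R f x) (at z within cbox s t) = k *\<^sub>R jacobian f (at z within cbox s t)"
proof -
  let ?F = "at z within cbox s t"
  have f: "(f has_derivative frechet_derivative f ?F) ?F"
    and g: "(g has_derivative frechet_derivative g ?F) ?F"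
    using assms(3,4) by (simp_all add: frechet_derivative_works)
  have fd: "frechet_derivative q ?F = q'" if "(q has_derivative q') ?F" for q :: "real ^ 'd \<Rightarrow> real ^ 'n" and q'
    using frechet_derivative_within_cbox[OF _ assms(2) that] assms(1) by blast
  show "jacobian (\<lambda>x. f x + g x) ?F = jacobian f ?F + jacobian g ?F"
    unfolding jacobian_def fd[OF has_derivative_add[OF f g]]
    by (simp add: matrix_def vec_eq_iff)
  show "jacobian (\<lambda>x. k *\<^sub>R f x) ?F = k *\<^sub>R jacobian f ?F"
    unfolding jacobian_def fd[OF has_derivative_scaleR_right[OF f]]
    by (simp add: matrix_def vec_eq_iff)
qed

text \<open>The vector triple product identity for a unit vector; the negative of the result is the
  orthogonal projection of \<open>x\<close> onto the plane normal to \<open>m\<close>.\<close>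

lemma cross3_cross3_unit:
  assumes "norm m = 1"
  shows "cross3 m (cross3 m x) = (m \<bullet> x) *\<^sub>R m - x"
proof -
  have "m \<bullet> m = 1" using assms by (simp add: norm_eq_1)
  moreover have "cross3 m (cross3 m x) = (m \<bullet> x) *\<^sub>R m - (m \<bullet> m) *\<^sub>R x"
    by (simp add: cross3_simps) (simp add: vec_eq_iff forall_3 algebra_simps)
  ultimately show ?thesis by simp
qed

section \<open>The finite element space\<close>

locale tensor_mesh =
  fixes a b :: "real ^ 'd::finite" and P :: "'d \<Rightarrow> real list"
  assumes partition: "tensor_partition a b P"
begin

abbreviation V where "V \<equiv> S1 (box a b) P"

section \<open>Geometry of the tensor product mesh\<close>

lemma length_partition: "2 \<le> length (P i)"
  using partition by (simp add: tensor_partition_def)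

lemma partition_less: "k < l \<Longrightarrow> l < length (P i) \<Longrightarrow> P i ! k < P i ! l"
  using partition by (auto simp: tensor_partition_def intro: sorted_wrt_nth_less)

lemma partition_le: "k \<le> l \<Longrightarrow> l < length (P i) \<Longrightarrow> P i ! k \<le> P i ! l"
  using partition_less[of k l i] by (cases "k = l") auto

lemma partition_first: "P i ! 0 = a $ i"
proof -
  have "P i \<noteq> []" using length_partition[of i] by auto
  then show ?thesis using partition by (simp add: tensor_partition_def flip: hd_conv_nth)
qed

lemma partition_last: "P i ! (length (P i) - 1) = b $ i"
proof -
  have "P i \<noteq> []" using length_partition[of i] by auto
  then show ?thesis using partition by (simp add: tensor_partition_def last_conv_nth[symmetric] del: One_nat_def)
qed

lemma a_less_b: "a $ i < b $ i"
  using partition_less[of 0 "length (P i) - 1" i] length_partition[of i]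
  unfolding partition_first partition_last by simp

lemma closure_domain: "closure (box a b) = cbox a b"
proof (rule closure_box)
  show "box a b \<noteq> {}" using a_less_b by (simp add: box_ne_empty Basis_vec_def inner_axis)
qed

lemma element_step: "j \<in> elements P \<Longrightarrow> P i ! j i < P i ! Suc (j i)"
  by (intro partition_less) (auto simp: elements_def)

lemma cell_Basis_less:
  "j \<in> elements P \<Longrightarrow> \<beta> \<in> Basis \<Longrightarrow> (\<chi> i. P i ! j i) \<bullet> \<beta> < (\<chi> i. P i ! Suc (j i)) \<bullet> \<beta>"
  using element_step by (auto simp: Basis_vec_def inner_axis)

lemma mem_cell: "x \<in> cell P j \<longleftrightarrow> (\<forall>i. P i ! j i \<le> x $ i \<and> x $ i \<le> P i ! Suc (j i))"
  by (simp add: cell_def mem_box_cart)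

lemma vertices_subset_cell: "j \<in> elements P \<Longrightarrow> vertices P j \<subseteq> cell P j"
proof
  fix z assume j: "j \<in> elements P" and "z \<in> vertices P j"
  then have "z $ i = P i ! j i \<or> z $ i = P i ! Suc (j i)" for i by (simp add: vertices_def)
  then show "z \<in> cell P j" unfolding mem_cell using element_step[OF j] by (metis less_imp_le order_refl)
qed

lemma cell_subset_domain: "j \<in> elements P \<Longrightarrow> cell P j \<subseteq> cbox a b"
proof
  fix x assume j: "j \<in> elements P" and x: "x \<in> cell P j"
  have "a $ i \<le> x $ i \<and> x $ i \<le> b $ i" for i
  proof -
    have l: "Suc (j i) < length (P i)" using j by (simp add: elements_def)
    have "a $ i \<le> P i ! j i"
      using partition_le[of 0 "j i" i] l unfolding partition_first by simp
    moreover have "P i ! Suc (j i) \<le> b $ i"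
      using partition_le[of "Suc (j i)" "length (P i) - 1" i] l unfolding partition_last by simp
    ultimately show ?thesis using x unfolding mem_cell by (meson order_trans)
  qed
  then show "x \<in> cbox a b" by (simp add: mem_box_cart)
qed

lemma domain_subset_cells:
  assumes "x \<in> cbox a b"
  obtains j where "j \<in> elements P" "x \<in> cell P j"
proof -
  have "\<exists>k. Suc k < length (P i) \<and> P i ! k \<le> x $ i \<and> x $ i \<le> P i ! Suc k" for i
  proof -
    have x: "a $ i \<le> x $ i" "x $ i \<le> b $ i" using assms by (auto simp: mem_box_cart)
    \<comment> \<open>The first subinterval whose right end is not to the left of the coordinate.
      Minimality places its left end on the correct side, except for \<open>k = 0\<close>, where
      that end is \<open>a $ i\<close>.\<close>
    define k where "k = (LEAST k. x $ i \<le> P i ! Suc k)"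
    have last: "Suc (length (P i) - 2) = length (P i) - 1" using length_partition[of i] by simp
    have ex: "x $ i \<le> P i ! Suc (length (P i) - 2)" using x(2) by (simp only: last partition_last)
    have le: "x $ i \<le> P i ! Suc k" unfolding k_def by (rule LeastI) (rule ex)
    have kl: "k \<le> length (P i) - 2" unfolding k_def by (rule Least_le) (rule ex)
    have "P i ! k \<le> x $ i"
    proof (cases k)
      case 0 then show ?thesis using x partition_first by simp
    next
      case (Suc n)
      have "\<not> x $ i \<le> P i ! Suc n" by (rule not_less_Least) (use Suc in \<open>simp add: k_def\<close>)
      then show ?thesis using Suc by simp
    qed
    then show ?thesis using le kl length_partition[of i] by (intro exI[of _ k]) auto
  qed
  then obtain j where "\<And>i. Suc (j i) < length (P i) \<and> P i ! j i \<le> x $ i \<and> x $ i \<le> P i ! Suc (j i)"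
    by metis
  then show ?thesis by (intro that[of j]) (auto simp: elements_def mem_cell)
qed

lemma finite_elements: "finite (elements P)"
proof (rule finite_subset)
  show "elements P \<subseteq> (\<Pi>\<^sub>E i\<in>UNIV. {..<length (P i)})"
    by (auto simp: elements_def PiE_def intro: Suc_lessD)
qed (intro finite_PiE finite, simp)

lemma finite_vertices: "finite (vertices P j)"
proof (rule finite_subset)
  show "vertices P j \<subseteq> vec_lambda ` (\<Pi>\<^sub>E i\<in>UNIV. {P i ! j i, P i ! Suc (j i)})"
  proof
    fix z assume "z \<in> vertices P j"
    then have "z = vec_lambda (vec_nth z)" "vec_nth z \<in> (\<Pi>\<^sub>E i\<in>UNIV. {P i ! j i, P i ! Suc (j i)})"
      by (auto simp: vertices_def PiE_def)
    then show "z \<in> vec_lambda ` (\<Pi>\<^sub>E i\<in>UNIV. {P i ! j i, P i ! Suc (j i)})" by blast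
  qed
qed (intro finite_imageI finite_PiE finite, simp)

lemma finite_nodes: "finite (nodes P)"
  by (simp add: nodes_def finite_elements finite_vertices)

lemma vertices_in_nodes: "j \<in> elements P \<Longrightarrow> z \<in> vertices P j \<Longrightarrow> z \<in> nodes P"
  by (auto simp: nodes_def)

lemma node_index:
  assumes "z \<in> nodes P"
  obtains k where "\<And>i. k i < length (P i)" "\<And>i. z $ i = P i ! k i"
proof -
  obtain j where "j \<in> elements P" "z \<in> vertices P j" using assms by (auto simp: nodes_def)
  then have "\<exists>k. k < length (P i) \<and> z $ i = P i ! k" for i
    by (auto simp: elements_def vertices_def dest!: spec[of _ i] intro: Suc_lessD)
  then show ?thesis using that by metis
qed

text \<open>Elements are nondegenerate boxes. Positive weights make \<open>inner_h\<close> definite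
  on nodal values.\<close>

lemma weight_pos: "j \<in> elements P \<Longrightarrow> weight P j > 0"
  using cell_Basis_less[of j] by (simp add: weight_def cell_def content_pos_lt_eq)

section \<open>Linear structure of the finite element space and nodal interpolation\<close>

lemma V_piece:
  assumes "v \<in> V" "j \<in> elements P"
  shows "\<exists>p\<in>Q1. \<forall>x\<in>cell P j. v x $ k = p x"
  using assms unfolding S1_def by blast

lemma V_add:
  assumes "v \<in> V" "w \<in> V"
  shows "(\<lambda>x. v x + w x) \<in> V"
proof -
  have "\<exists>p\<in>Q1. \<forall>x\<in>cell P j. (v x + w x) $ k = p x" if "j \<in> elements P" for j k
  proof -
    obtain p where "p \<in> Q1" "\<And>x. x \<in> cell P j \<Longrightarrow> v x $ k = p x"
      using V_piece[OF assms(1) \<open>j \<in> elements P\<close>, where k = k] by blast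
    moreover obtain q where "q \<in> Q1" "\<And>x. x \<in> cell P j \<Longrightarrow> w x $ k = q x"
      using V_piece[OF assms(2) \<open>j \<in> elements P\<close>, where k = k] by blast
    ultimately show ?thesis by (intro bexI[of _ "\<lambda>x. p x + q x"] Q1_add) auto
  qed
  then show ?thesis using assms by (auto simp: S1_def intro: H1_add)
qed

lemma V_scale:
  assumes "v \<in> V"
  shows "(\<lambda>x. c *\<^sub>R v x) \<in> V"
proof -
  have "\<exists>p\<in>Q1. \<forall>x\<in>cell P j. (c *\<^sub>R v x) $ k = p x" if "j \<in> elements P" for j k
  proof -
    obtain p where "p \<in> Q1" "\<And>x. x \<in> cell P j \<Longrightarrow> v x $ k = p x"
      using V_piece[OF assms \<open>j \<in> elements P\<close>, where k = k] by blast
    then show ?thesis by (intro bexI[of _ "\<lambda>x. c * p x"] Q1_scale) auto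
  qed
  then show ?thesis using assms by (auto simp: S1_def intro: H1_scale)
qed

text \<open>Unisolvence applies to every component on every cell, the cells cover the closed domain,
  and outside it the functions are normalised to 0.\<close>

lemma V_eq_0_if_0_on_nodes:
  assumes "v \<in> V" "\<And>z. z \<in> nodes P \<Longrightarrow> v z = 0"
  shows "v = (\<lambda>x. 0)"
proof
  fix x show "v x = 0"
  proof (cases "x \<in> cbox a b")
    case True
    then obtain j where j: "j \<in> elements P" "x \<in> cell P j" by (rule domain_subset_cells)
    have "v x $ k = 0" for k
    proof -
      obtain p where p: "p \<in> Q1" "\<And>x. x \<in> cell P j \<Longrightarrow> v x $ k = p x"
        using V_piece[OF assms(1) j(1), where k = k] by blast
      have "p x = 0"
      proof (rule Q1_eq_0_if_0_at_vertices[OF p(1) element_step[OF j(1)]])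
        fix z assume "\<And>i. z $ i = P i ! j i \<or> z $ i = P i ! Suc (j i)"
        then have z: "z \<in> vertices P j" by (simp add: vertices_def)
        then have "v z $ k = 0" using assms(2)[OF vertices_in_nodes[OF j(1)]] by simp
        then show "p z = 0" using p(2) vertices_subset_cell[OF j(1)] z by auto
      qed
      then show ?thesis using p j by simp
    qed
    then show ?thesis by (simp add: vec_eq_iff)
  next
    case False
    then show ?thesis using assms(1) by (simp add: S1_def closure_domain)
  qed
qed

text \<open>The basis function is the product of hats centred at the coordinates of
  \<open>z\<close>, cut off outside the closed domain. Another node has a different grid index in
  some direction, where the hat vanishes. No kink is interior to a mesh interval, so the product is
  multi-affine on each cell.\<close>

lemma nodal_basis_exists:
  assumes "z \<in> nodes P"
  shows "\<exists>\<phi>. \<phi> z = 1 \<and> (\<forall>y\<in>nodes P. y \<noteq> z \<longrightarrow> \<phi> y = 0) \<and> (\<forall>e. (\<lambda>x. \<phi> x *\<^sub>R e) \<in> V)"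
proof -
  obtain k where k: "\<And>i. k i < length (P i)" "\<And>i. z $ i = P i ! k i"
    using node_index[OF assms] by metis
  \<comment> \<open>At the two ends of the partition a fictitious neighbour at distance 1 keeps the hat two-sided.\<close>
  define l where "l i = (if k i = 0 then P i ! 0 - 1 else P i ! (k i - 1))" for i
  define c where "c i = P i ! k i" for i
  define r where "r i = (if Suc (k i) < length (P i) then P i ! Suc (k i) else P i ! k i + 1)" for i
  have lc: "l i < c i" and cr: "c i < r i" for i
    using k(1)[of i] partition_less[of "k i - 1" "k i" i] partition_less[of "k i" "Suc (k i)" i]
    by (auto simp: l_def c_def r_def)
  define \<phi> where "\<phi> x = (if x \<in> cbox a b then \<Prod>i\<in>UNIV. hat (l i) (c i) (r i) (x $ i) else 0)" for x
  have in_dom: "y \<in> cbox a b" if "y \<in> nodes P" for y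
    using that vertices_subset_cell cell_subset_domain unfolding nodes_def by blast
  have "\<phi> z = 1"
    using in_dom[OF assms] hat_center[OF lc cr] by (simp add: \<phi>_def k(2) c_def[symmetric])
  moreover have "\<phi> y = 0" if y: "y \<in> nodes P" "y \<noteq> z" for y
  proof -
    obtain m where m: "\<And>i. m i < length (P i)" "\<And>i. y $ i = P i ! m i"
      using node_index[OF y(1)] by metis
    obtain i where i: "m i \<noteq> k i" using y(2) m k by (metis vec_eq_iff)
    have "y $ i \<le> l i \<or> r i \<le> y $ i"
    proof (cases "m i < k i")
      case True
      then show ?thesis using partition_le[of "m i" "k i - 1" i] k(1)[of i] m(2)[of i]
        by (auto simp: l_def)
    next
      case False
      then show ?thesis using i partition_le[of "Suc (k i)" "m i" i] m(1)[of i] m(2)[of i]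
        by (auto simp: r_def)
    qed
    then have "hat (l i) (c i) (r i) (y $ i) = 0" by (rule hat_eq(1)[OF lc cr])
    then have "(\<Prod>i\<in>UNIV. hat (l i) (c i) (r i) (y $ i)) = 0" by (intro prod_zero) auto
    then show ?thesis by (simp add: \<phi>_def)
  qed
  moreover have "(\<lambda>x. \<phi> x *\<^sub>R e) \<in> V" for e
  proof -
    have "(\<lambda>x. \<phi> x * e $ q) \<in> H1 (box a b)" for q
    proof (rule H1_cong[OF H1_scale[OF tensor_hat_H1[OF lc cr]]])
      fix x assume "x \<in> box a b"
      then have "x \<in> cbox a b" using box_subset_cbox by blast
      then show "e $ q * (\<Prod>i\<in>UNIV. hat (l i) (c i) (r i) (x $ i)) = \<phi> x * e $ q"
        by (simp add: \<phi>_def)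
    qed
    moreover have "\<exists>p\<in>Q1. \<forall>x\<in>cell P j. \<phi> x * e $ q = p x" if j: "j \<in> elements P" for j q
    proof -
      have "\<exists>\<alpha> \<beta>. \<forall>t. P i ! j i \<le> t \<longrightarrow> t \<le> P i ! Suc (j i) \<longrightarrow> hat (l i) (c i) (r i) t = \<alpha> + \<beta> * t" for i
      proof -
        have jl: "Suc (j i) < length (P i)" using j by (simp add: elements_def)
        have grid: "P i ! n \<le> P i ! j i \<or> P i ! Suc (j i) \<le> P i ! n" if "n < length (P i)" for n
          using partition_le[of n "j i" i] partition_le[of "Suc (j i)" n i] that jl
          by (cases "n \<le> j i") auto
        have "p \<le> P i ! j i \<or> P i ! Suc (j i) \<le> p" if "p \<in> {l i, c i, r i}" for p
        proof -
          \<comment> \<open>True neighbours are partition points and fall under \<open>grid\<close>;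
            a fictitious neighbour lies beyond the whole partition.\<close>
          have "l i \<le> P i ! j i \<or> P i ! Suc (j i) \<le> l i"
            using grid[of "k i - 1"] k(1)[of i] partition_le[of 0 "j i" i] jl by (auto simp: l_def)
          moreover have "c i \<le> P i ! j i \<or> P i ! Suc (j i) \<le> c i"
            using grid[of "k i"] k(1)[of i] by (simp add: c_def)
          moreover have "r i \<le> P i ! j i \<or> P i ! Suc (j i) \<le> r i"
          proof (cases "Suc (k i) < length (P i)")
            case True then show ?thesis using grid[of "Suc (k i)"] by (simp add: r_def)
          next
            case False
            then have "P i ! Suc (j i) \<le> P i ! k i" using k(1)[of i] jl by (intro partition_le) auto
            then show ?thesis using False by (simp add: r_def)
          qed
          ultimately show ?thesis using that by auto
        qed
        from hat_affine_on_interval[OF lc cr this] show ?thesis by metis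
      qed
      then obtain \<alpha> \<beta> where ab: "\<And>i t. P i ! j i \<le> t \<Longrightarrow> t \<le> P i ! Suc (j i) \<Longrightarrow>
          hat (l i) (c i) (r i) t = \<alpha> i + \<beta> i * t"
        by metis
      have "\<phi> x * e $ q = e $ q * (\<Prod>i\<in>UNIV. \<alpha> i + \<beta> i * x $ i)" if "x \<in> cell P j" for x
      proof -
        have "x \<in> cbox a b" using that cell_subset_domain[OF j] by blast
        moreover have "(\<Prod>i\<in>UNIV. hat (l i) (c i) (r i) (x $ i)) = (\<Prod>i\<in>UNIV. \<alpha> i + \<beta> i * x $ i)"
          using that unfolding mem_cell by (intro prod.cong) (auto simp: ab)
        ultimately show ?thesis by (simp add: \<phi>_def)
      qed
      then show ?thesis
        by (intro bexI[of _ "\<lambda>x. e $ q * (\<Prod>i\<in>UNIV. \<alpha> i + \<beta> i * x $ i)"] Q1_scale Q1_prod_affine) auto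
    qed
    ultimately show ?thesis by (auto simp: S1_def closure_domain \<phi>_def)
  qed
  ultimately show ?thesis by blast
qed

lemma V_zero: "(\<lambda>x. 0) \<in> V"
proof -
  have "(\<lambda>x. 0) \<in> H1 (box a b)"
    by (auto simp: H1_def L2_def weak_partial_def intro!: exI[of _ "\<lambda>x. 0"] bexI[of _ "\<lambda>x. 0"])
  moreover have "(\<lambda>x. 0) \<in> Q1" by (auto simp: Q1_def intro!: exI[of _ "\<lambda>S. 0"])
  ultimately show ?thesis by (auto simp: S1_def intro!: bexI[of _ "\<lambda>x. 0"])
qed

lemma V_sum: "(\<And>i. i \<in> I \<Longrightarrow> f i \<in> V) \<Longrightarrow> (\<lambda>x. \<Sum>i\<in>I. f i x) \<in> V"
  by (induction I rule: infinite_finite_induct) (auto intro: V_zero V_add)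

lemma V_diff: "v \<in> V \<Longrightarrow> w \<in> V \<Longrightarrow> (\<lambda>x. v x - w x) \<in> V"
  using V_add[of v "\<lambda>x. (- 1) *\<^sub>R w x"] V_scale[of w "- 1"] by simp

lemma V_eqI:
  assumes "v \<in> V" "w \<in> V" "\<And>z. z \<in> nodes P \<Longrightarrow> v z = w z"
  shows "v = w"
  using V_eq_0_if_0_on_nodes[OF V_diff[OF assms(1,2)]] assms(3) by (simp add: fun_eq_iff)

text \<open>The combination of nodal basis functions with coefficients \<open>f z\<close>: at each
  node a single term survives.\<close>

lemma V_interpolates: "\<exists>v\<in>V. \<forall>z\<in>nodes P. v z = f z"
proof -
  obtain \<phi> where \<phi>: "\<And>z. z \<in> nodes P \<Longrightarrow> \<phi> z z = (1::real)"
    "\<And>z y. z \<in> nodes P \<Longrightarrow> y \<in> nodes P \<Longrightarrow> y \<noteq> z \<Longrightarrow> \<phi> z y = 0"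
    "\<And>z e. z \<in> nodes P \<Longrightarrow> (\<lambda>x. \<phi> z x *\<^sub>R e) \<in> V"
    using nodal_basis_exists by metis
  let ?v = "\<lambda>x. \<Sum>z\<in>nodes P. \<phi> z x *\<^sub>R f z"
  have "?v y = f y" if y: "y \<in> nodes P" for y
  proof -
    have "?v y = (\<Sum>z\<in>nodes P. if z = y then f y else 0)"
      using \<phi>(1,2) y by (intro sum.cong) auto
    then show ?thesis using y finite_nodes by simp
  qed
  moreover have "?v \<in> V" using \<phi>(3) by (intro V_sum)
  ultimately show ?thesis by (intro bexI[of _ ?v] ballI)
qed

section \<open>The discrete inner products and the discrete Laplacian\<close>

text \<open>Mass lumping: only pointwise products at the nodes enter. Functions outside the finite
  element space, such as the double cross product, can therefore be handled node by node.\<close>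

lemma inner_h_cong:
  assumes "\<And>z. z \<in> nodes P \<Longrightarrow> v z \<bullet> w z = v' z \<bullet> w' z"
  shows "inner_h P v w = inner_h P v' w'"
  unfolding inner_h_def using assms by (intro sum.cong refl) (simp add: vertices_in_nodes)

lemma inner_h_add_right: "inner_h P v (\<lambda>x. w x + w' x) = inner_h P v w + inner_h P v w'"
  by (simp add: inner_h_def inner_add_right distrib_left sum.distrib)

lemma inner_h_scale_right: "inner_h P v (\<lambda>x. k *\<^sub>R w x) = k * inner_h P v w"
  by (simp add: inner_h_def sum_distrib_left mult_ac)

lemma inner_h_diff_left: "inner_h P (\<lambda>x. v x - v' x) w = inner_h P v w - inner_h P v' w"
  by (simp add: inner_h_def inner_diff_left right_diff_distrib sum_subtractf)

lemma inner_h_minus_left: "inner_h P (\<lambda>x. - v x) w = - inner_h P v w"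
  by (simp add: inner_h_def sum_negf)

lemma inner_h_self_eq_0D:
  assumes "inner_h P v v = 0" "z \<in> nodes P"
  shows "v z = 0"
proof -
  obtain j where j: "j \<in> elements P" "z \<in> vertices P j" using assms(2) by (auto simp: nodes_def)
  have nonneg: "0 \<le> weight P j * (v z \<bullet> v z)" if "j \<in> elements P" for j z
    using weight_pos[OF that] by simp
  have "(\<Sum>z\<in>vertices P j. weight P j * (v z \<bullet> v z)) = 0"
    using assms(1) j(1) unfolding inner_h_def
    by (subst (asm) sum_nonneg_eq_0_iff) (auto simp: finite_elements intro!: sum_nonneg nonneg)
  then have "weight P j * (v z \<bullet> v z) = 0"
    using j nonneg[OF j(1)] by (subst (asm) sum_nonneg_eq_0_iff) (auto simp: finite_vertices)
  then show ?thesis using weight_pos[OF j(1)] by simp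
qed

text \<open>Within one closed cell the components agree with polynomials, although the function may
  have kinks across cell faces.\<close>

lemma V_differentiable:
  assumes "v \<in> V" "j \<in> elements P" "z \<in> vertices P j"
  shows "v differentiable (at z within cell P j)"
proof -
  have z: "z \<in> cell P j" using vertices_subset_cell assms by blast
  have "(\<lambda>x. v x $ k) differentiable (at z within cell P j)" for k
  proof -
    obtain p where p: "p \<in> Q1" "\<And>x. x \<in> cell P j \<Longrightarrow> v x $ k = p x"
      using V_piece[OF assms(1,2), of k] by blast
    show ?thesis
      by (rule differentiable_transform_within[OF Q1_differentiable[OF p(1)] zero_less_one z])
        (simp add: p(2))
  qed
  then have "\<forall>\<beta>\<in>Basis. (\<lambda>x. v x \<bullet> \<beta>) differentiable (at z within cell P j)"
    by (auto simp: Basis_vec_def inner_axis)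
  then show ?thesis using differentiable_componentwise_within by blast
qed

lemma
  assumes "v \<in> V" "w \<in> V" "j \<in> elements P" "z \<in> vertices P j"
  shows V_jacobian_add: "jacobian (\<lambda>x. v x + w x) (at z within cell P j) =
      jacobian v (at z within cell P j) + jacobian w (at z within cell P j)"
    and V_jacobian_scale: "jacobian (\<lambda>x. k *\<^sub>R v x) (at z within cell P j) =
      k *\<^sub>R jacobian v (at z within cell P j)"
  using jacobian_add_scale_cbox[OF cell_Basis_less[OF assms(3)], of z v w]
    V_differentiable[OF assms(1,3,4)] V_differentiable[OF assms(2,3,4)]
    vertices_subset_cell[OF assms(3)] assms(4)
  unfolding cell_def by blast+

lemma grad_inner_h_sym: "grad_inner_h P v w = grad_inner_h P w v"
  by (simp add: grad_inner_h_def inner_commute)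

lemma grad_inner_h_add_left:
  assumes "v \<in> V" "v' \<in> V"
  shows "grad_inner_h P (\<lambda>x. v x + v' x) w = grad_inner_h P v w + grad_inner_h P v' w"
proof -
  have "grad_inner_h P (\<lambda>x. v x + v' x) w = (\<Sum>j\<in>elements P. \<Sum>z\<in>vertices P j.
      weight P j * (jacobian v (at z within cell P j) \<bullet> jacobian w (at z within cell P j)) +
      weight P j * (jacobian v' (at z within cell P j) \<bullet> jacobian w (at z within cell P j)))"
    unfolding grad_inner_h_def using assms
    by (intro sum.cong refl) (simp add: V_jacobian_add inner_add_left distrib_left)
  then show ?thesis by (simp add: grad_inner_h_def sum.distrib)
qed

lemma grad_inner_h_scale_left:
  assumes "v \<in> V"
  shows "grad_inner_h P (\<lambda>x. k *\<^sub>R v x) w = k * grad_inner_h P v w"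
proof -
  have "grad_inner_h P (\<lambda>x. k *\<^sub>R v x) w = (\<Sum>j\<in>elements P. \<Sum>z\<in>vertices P j.
      k * (weight P j * (jacobian v (at z within cell P j) \<bullet> jacobian w (at z within cell P j))))"
    unfolding grad_inner_h_def using assms
    by (intro sum.cong refl) (simp add: V_jacobian_scale[OF assms assms])
  then show ?thesis by (simp add: grad_inner_h_def sum_distrib_left)
qed

text \<open>\<open>w\<close> is the combination of the vector-valued basis functions
  \<open>B z k\<close> with its own nodal components. Linearity is required on the space only,
  because the gradient form is linear only where Jacobians exist.\<close>

lemma linear_functional_expansion:
  fixes F :: "(real ^ 'd \<Rightarrow> real ^ 3) \<Rightarrow> real"
  assumes add: "\<And>v w. v \<in> V \<Longrightarrow> w \<in> V \<Longrightarrow> F (\<lambda>x. v x + w x) = F v + F w"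
    and scale: "\<And>k v. v \<in> V \<Longrightarrow> F (\<lambda>x. k *\<^sub>R v x) = k * F v"
    and B: "\<And>z k. z \<in> nodes P \<Longrightarrow> B z k \<in> V"
      "\<And>z k y. z \<in> nodes P \<Longrightarrow> y \<in> nodes P \<Longrightarrow> B z k y = (if y = z then axis k 1 else 0)"
    and w: "w \<in> V"
  shows "F w = (\<Sum>z\<in>nodes P. \<Sum>k\<in>UNIV. w z $ k * F (B z k))"
proof -
  have zero: "F (\<lambda>x. 0) = 0" using scale[OF V_zero, of 0] by simp
  \<comment> \<open>The index type is left general, as the fact serves for sums over nodes and over
    components.\<close>
  have F_sum: "F (\<lambda>x. \<Sum>i\<in>I. f i x) = (\<Sum>i\<in>I. F (f i))" if "\<And>i. i \<in> I \<Longrightarrow> f i \<in> V"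
    for I :: "'x set" and f
    using that by (induction I rule: infinite_finite_induct) (auto simp: zero add V_sum)
  let ?w = "\<lambda>x. \<Sum>z\<in>nodes P. \<Sum>k\<in>UNIV. w z $ k *\<^sub>R B z k x"
  have "w = ?w"
  proof (rule V_eqI[OF w])
    show "?w \<in> V" by (intro V_sum V_scale B(1))
    fix y assume y: "y \<in> nodes P"
    have "?w y = (\<Sum>z\<in>nodes P. if z = y then (\<Sum>k\<in>UNIV. w y $ k *\<^sub>R axis k 1) else 0)"
      using B(2) y by (intro sum.cong) auto
    also have "\<dots> = (\<Sum>k\<in>UNIV. w y $ k *\<^sub>R axis k 1)" using y finite_nodes by simp
    also have "\<dots> = w y" using basis_expansion[of "w y"] by (simp add: scalar_mult_eq_scaleR)
    finally show "w y = ?w y" by simp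
  qed
  then have "F w = F ?w" by simp
  also have "\<dots> = (\<Sum>z\<in>nodes P. F (\<lambda>x. \<Sum>k\<in>UNIV. w z $ k *\<^sub>R B z k x))"
    by (rule F_sum) (intro V_sum V_scale B(1))
  also have "\<dots> = (\<Sum>z\<in>nodes P. \<Sum>k\<in>UNIV. F (\<lambda>x. w z $ k *\<^sub>R B z k x))"
    by (intro sum.cong refl F_sum V_scale B(1))
  also have "\<dots> = (\<Sum>z\<in>nodes P. \<Sum>k\<in>UNIV. w z $ k * F (B z k))"
    by (intro sum.cong refl scale B(1))
  finally show ?thesis .
qed

text \<open>The nodal basis is orthogonal for \<open>inner_h\<close>, so the representing function
  is found by dividing in each component. Uniqueness is definiteness on nodal values together with
  unisolvence.\<close>

lemma riesz_representation:
  fixes F :: "(real ^ 'd \<Rightarrow> real ^ 3) \<Rightarrow> real"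
  assumes add: "\<And>v w. v \<in> V \<Longrightarrow> w \<in> V \<Longrightarrow> F (\<lambda>x. v x + w x) = F v + F w"
    and scale: "\<And>k v. v \<in> V \<Longrightarrow> F (\<lambda>x. k *\<^sub>R v x) = k * F v"
  shows "\<exists>!L. L \<in> V \<and> (\<forall>w\<in>V. inner_h P L w = F w)"
proof (rule ex_ex1I)
  have "\<forall>z k. \<exists>B. B \<in> V \<and> (\<forall>y\<in>nodes P. B y = (if y = z then axis k 1 else 0))"
  proof (intro allI)
    fix z and k :: 3
    show "\<exists>B. B \<in> V \<and> (\<forall>y\<in>nodes P. B y = (if y = z then axis k 1 else 0))"
      using V_interpolates[of "\<lambda>y. if y = z then axis k 1 else 0"] by blast
  qed
  then obtain B where B: "\<And>z k. B z k \<in> V"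
    "\<And>z k y. y \<in> nodes P \<Longrightarrow> B z k y = (if y = z then axis k 1 else 0)"
    by metis
  define N where "N z k = inner_h P (B z k) (B z k)" for z k
  have N: "N z k \<noteq> 0" if z: "z \<in> nodes P" for z k
  proof
    assume "N z k = 0"
    then have "B z k z = 0" using inner_h_self_eq_0D z by (simp add: N_def)
    then show False using B(2)[OF z] by (simp add: axis_eq_0_iff)
  qed
  obtain L where L: "L \<in> V" "\<And>z. z \<in> nodes P \<Longrightarrow> L z = (\<chi> k. F (B z k) / N z k)"
    using V_interpolates[of "\<lambda>z. \<chi> k. F (B z k) / N z k"] by blast
  have LB: "inner_h P L (B z k) = F (B z k)" if z: "z \<in> nodes P" for z k
  proof -
    \<comment> \<open>Against \<open>B z k\<close> only component \<open>k\<close> of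
      \<open>L\<close> at \<open>z\<close> counts, so \<open>L\<close> may be replaced by a multiple
      of \<open>B z k\<close>.\<close>
    have "inner_h P L (B z k) = inner_h P (B z k) (\<lambda>x. (F (B z k) / N z k) *\<^sub>R B z k x)"
      by (rule inner_h_cong) (simp add: B(2) L(2) inner_axis)
    then show ?thesis using N[OF z] by (simp add: inner_h_scale_right N_def)
  qed
  have "inner_h P L w = F w" if w: "w \<in> V" for w
  proof -
    have "inner_h P L w = (\<Sum>z\<in>nodes P. \<Sum>k\<in>UNIV. w z $ k * inner_h P L (B z k))"
      by (rule linear_functional_expansion[OF _ _ _ _ w])
        (simp_all only: inner_h_add_right inner_h_scale_right B)
    also have "\<dots> = (\<Sum>z\<in>nodes P. \<Sum>k\<in>UNIV. w z $ k * F (B z k))"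
      by (intro sum.cong refl) (simp only: LB)
    also have "\<dots> = F w"
      by (rule linear_functional_expansion[OF _ _ _ _ w, symmetric])
        (simp_all only: add scale B)
    finally show ?thesis .
  qed
  then show "\<exists>L. L \<in> V \<and> (\<forall>w\<in>V. inner_h P L w = F w)" using L(1) by blast
next
  fix L L' assume "L \<in> V \<and> (\<forall>w\<in>V. inner_h P L w = F w)" "L' \<in> V \<and> (\<forall>w\<in>V. inner_h P L' w = F w)"
  then have LL: "L \<in> V" "L' \<in> V" "\<And>w. w \<in> V \<Longrightarrow> inner_h P (\<lambda>x. L x - L' x) w = 0"
    by (auto simp: inner_h_diff_left)
  have "L z - L' z = 0" if "z \<in> nodes P" for z
    using inner_h_self_eq_0D[OF LL(3)[OF V_diff[OF LL(1,2)]] that] .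
  then show "L = L'" by (intro V_eqI LL) auto
qed

text \<open>Riesz representation of the negative gradient form justifies the definite description.
  Symmetry of the form moves the test function to the left argument, where linearity is
  available.\<close>

lemma discrete_laplacian:
  assumes "v \<in> V"
  shows "discrete_laplacian (box a b) P v \<in> V"
    and "w \<in> V \<Longrightarrow> inner_h P (discrete_laplacian (box a b) P v) w = - grad_inner_h P v w"
proof -
  have "\<exists>!L. L \<in> V \<and> (\<forall>w\<in>V. inner_h P L w = - grad_inner_h P v w)"
    by (rule riesz_representation)
      (simp_all add: grad_inner_h_sym[of v] grad_inner_h_add_left grad_inner_h_scale_left)
  from theI'[OF this] show "discrete_laplacian (box a b) P v \<in> V"
    "w \<in> V \<Longrightarrow> inner_h P (discrete_laplacian (box a b) P v) w = - grad_inner_h P v w"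
    by (simp_all add: discrete_laplacian_def)
qed

section \<open>Equivalence of the schemes\<close>

text \<open>All nodal values are available for testing, so the variational identity decouples into
  one vector equation per node, in which the double cross product is minus the tangential
  projection.\<close>

lemma projection_step_iff_nodal:
  assumes unit: "\<And>z. z \<in> nodes P \<Longrightarrow> norm (m z) = 1"
  shows "(\<forall>v\<in>V. inner_h P u v = - inner_h P (\<lambda>x. cross3 (m x) (cross3 (m x) (L x))) v) \<longleftrightarrow>
      (\<forall>z\<in>nodes P. u z = L z - (m z \<bullet> L z) *\<^sub>R m z)" (is "?A \<longleftrightarrow> ?B")
proof
  assume ?A
  \<comment> \<open>The test function interpolates the nodal defect, so testing yields the squared
    discrete norm of the defect.\<close>
  obtain d where d: "d \<in> V" "\<And>z. z \<in> nodes P \<Longrightarrow> d z = u z - (L z - (m z \<bullet> L z) *\<^sub>R m z)"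
    using V_interpolates[of "\<lambda>z. u z - (L z - (m z \<bullet> L z) *\<^sub>R m z)"] by blast
  have "inner_h P d d = inner_h P (\<lambda>x. u x - (- cross3 (m x) (cross3 (m x) (L x)))) d"
    by (rule inner_h_cong) (simp add: d(2) cross3_cross3_unit[OF unit])
  also have "\<dots> = 0" unfolding inner_h_diff_left inner_h_minus_left using \<open>?A\<close> d(1) by simp
  finally show ?B using inner_h_self_eq_0D d(2) by fastforce
next
  assume ?B
  show ?A
  proof
    fix v assume "v \<in> V"
    have "inner_h P u v = inner_h P (\<lambda>x. - cross3 (m x) (cross3 (m x) (L x))) v"
      by (rule inner_h_cong) (simp add: \<open>?B\<close>[rule_format] cross3_cross3_unit[OF unit])
    then show "inner_h P u v = - inner_h P (\<lambda>x. cross3 (m x) (cross3 (m x) (L x))) v"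
      by (simp only: inner_h_minus_left)
  qed
qed

text \<open>For tangential \<open>u\<close> the defect from the projection of \<open>L\<close> is
  itself tangential and hence an admissible test function. Conversely, tangential test functions do
  not see the part of \<open>L\<close> along \<open>m\<close>.\<close>

lemma tangent_step_iff_nodal:
  assumes unit: "\<And>z. z \<in> nodes P \<Longrightarrow> norm (m z) = 1" and u: "u \<in> V"
  shows "u \<in> tangent_space (box a b) P m \<and>
      (\<forall>w\<in>tangent_space (box a b) P m. inner_h P u w = inner_h P L w) \<longleftrightarrow>
      (\<forall>z\<in>nodes P. u z = L z - (m z \<bullet> L z) *\<^sub>R m z)" (is "?A \<longleftrightarrow> ?B")
proof
  have mm: "m z \<bullet> m z = 1" if "z \<in> nodes P" for z using unit[OF that] by (simp add: norm_eq_1)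
  {
    assume ?A
    then have um: "u z \<bullet> m z = 0" if "z \<in> nodes P" for z
      using that by (simp add: tangent_space_def)
    obtain d where d: "d \<in> V" "\<And>z. z \<in> nodes P \<Longrightarrow> d z = u z - (L z - (m z \<bullet> L z) *\<^sub>R m z)"
      using V_interpolates[of "\<lambda>z. u z - (L z - (m z \<bullet> L z) *\<^sub>R m z)"] by blast
    \<comment> \<open>Orthogonality to \<open>m\<close> makes \<open>d\<close> admissible and also
      lets the normal part of \<open>L\<close> be dropped from the product with
      \<open>d\<close>.\<close>
    have dm: "d z \<bullet> m z = 0" if "z \<in> nodes P" for z
      using mm[OF that] um[OF that] by (simp add: d(2)[OF that] inner_diff_left inner_commute[of "L z"])
    have "inner_h P d d = inner_h P (\<lambda>x. u x - L x) d"
      by (rule inner_h_cong) (use dm in \<open>simp add: d(2) inner_diff_left inner_commute inner_add_left\<close>)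
    also have "\<dots> = 0" using \<open>?A\<close> d(1) dm by (simp add: inner_h_diff_left tangent_space_def)
    finally show ?B using inner_h_self_eq_0D d(2) by fastforce
  }
  {
    assume B: ?B
    have "u z \<bullet> m z = 0" if "z \<in> nodes P" for z
      using B[rule_format, OF that] mm[OF that] by (simp add: inner_diff_left inner_commute[of "L z"])
    moreover have "inner_h P u w = inner_h P L w" if "w \<in> tangent_space (box a b) P m" for w
      by (rule inner_h_cong)
        (use that B in \<open>simp add: tangent_space_def inner_diff_left inner_commute[of "m _" "w _"]\<close>)
    ultimately show ?A using u by (simp add: tangent_space_def)
  }
qed

text \<open>Both schemes reduce to the same nodal condition: \<open>u\<close> is the tangential part
  of the discrete Laplacian of \<open>mt\<close>. The normalisation steps agree because
  \<open>m x + \<Delta>t *\<^sub>R u x\<close> is \<open>mt x\<close>.\<close>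

theorem projection_scheme_iff_tangent_plane_scheme:
  assumes dt: "\<Delta>t > 0" and m: "m \<in> V" and unit: "\<And>z. z \<in> nodes P \<Longrightarrow> norm (m z) = 1"
  shows "projection_scheme (box a b) P \<Delta>t m mt m' \<longleftrightarrow>
    tangent_plane_scheme (box a b) P \<Delta>t m (\<lambda>x. (mt x - m x) /\<^sub>R \<Delta>t) m'"
proof (cases "mt \<in> V")
  case False
  \<comment> \<open>If \<open>mt\<close> is outside the space, so is the increment, since
    \<open>mt\<close> is recovered from it linearly; then both schemes fail.\<close>
  have "mt = (\<lambda>x. m x + \<Delta>t *\<^sub>R ((mt x - m x) /\<^sub>R \<Delta>t))" using dt by simp
  then have "(\<lambda>x. (mt x - m x) /\<^sub>R \<Delta>t) \<notin> V"
    using False V_add[OF m V_scale[of "\<lambda>x. (mt x - m x) /\<^sub>R \<Delta>t" \<Delta>t]] by auto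
  then show ?thesis
    using False by (simp add: projection_scheme_def tangent_plane_scheme_def tangent_space_def)
next
  case True
  define u where "u x = (mt x - m x) /\<^sub>R \<Delta>t" for x
  define L where "L = discrete_laplacian (box a b) P mt"
  have u: "u \<in> V" unfolding u_def using V_scale[OF V_diff[OF True m]] by simp
  have mt: "mt = (\<lambda>x. m x + \<Delta>t *\<^sub>R u x)" using dt by (simp add: u_def)
  have L: "L \<in> V" "\<And>w. w \<in> V \<Longrightarrow> inner_h P L w = - grad_inner_h P mt w"
    using discrete_laplacian[OF True] by (simp_all add: L_def)
  \<comment> \<open>Linearity of the gradient form splits the implicit Laplacian into the increment
    term with factor \<open>\<Delta>t\<close> and the term of the old iterate.\<close>
  have "inner_h P L w = - (\<Delta>t * grad_inner_h P u w + grad_inner_h P m w)" if "w \<in> V" for w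
    using L(2)[OF that] grad_inner_h_add_left[OF m V_scale[OF u]] grad_inner_h_scale_left[OF u]
    by (simp add: mt)
  then have step: "inner_h P u w + \<Delta>t * grad_inner_h P u w + grad_inner_h P m w = 0 \<longleftrightarrow>
      inner_h P u w = inner_h P L w" if "w \<in> tangent_space (box a b) P m" for w
    using that by (auto simp: tangent_space_def)
  have mtx: "m x + \<Delta>t *\<^sub>R u x = mt x" for x by (simp add: mt)
  have tangent: "u \<in> tangent_space (box a b) P m \<and>
      (\<forall>w\<in>tangent_space (box a b) P m. inner_h P u w = inner_h P L w) \<longleftrightarrow>
      (\<forall>z\<in>nodes P. u z = L z - (m z \<bullet> L z) *\<^sub>R m z)"
    using unit u by (rule tangent_step_iff_nodal)
  have projection: "(\<forall>v\<in>V. inner_h P u v = - inner_h P (\<lambda>x. cross3 (m x) (cross3 (m x) (L x))) v) \<longleftrightarrow>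
      (\<forall>z\<in>nodes P. u z = L z - (m z \<bullet> L z) *\<^sub>R m z)"
    using unit by (rule projection_step_iff_nodal)
  have "tangent_plane_scheme (box a b) P \<Delta>t m u m' \<longleftrightarrow>
      (\<forall>z\<in>nodes P. u z = L z - (m z \<bullet> L z) *\<^sub>R m z) \<and>
      m' = nodal_interp (box a b) P (\<lambda>x. mt x /\<^sub>R norm (mt x))"
    unfolding tangent_plane_scheme_def tangent[symmetric] mtx
    by (simp only: step conj_assoc cong: ball_cong)
  moreover have "projection_scheme (box a b) P \<Delta>t m mt m' \<longleftrightarrow>
      (\<forall>z\<in>nodes P. u z = L z - (m z \<bullet> L z) *\<^sub>R m z) \<and>
      m' = nodal_interp (box a b) P (\<lambda>x. mt x /\<^sub>R norm (mt x))"
    unfolding projection_scheme_def projection[symmetric]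
    using True by (simp add: u_def[abs_def] L_def)
  ultimately show ?thesis by (simp add: u_def[abs_def])
qed

end

text \<open>The substitution is stated in both directions, so solutions correspond one to one. The
  last clause ensures that the nodal normalisation never divides by zero.\<close>

theorem mainTheorem7:
  fixes \<Omega> :: "(real ^ 'd::finite) set" and a b :: "real ^ 'd"
    and P :: "'d \<Rightarrow> real list" and \<Delta>t :: real and m :: "real ^ 'd \<Rightarrow> real ^ 3"
  assumes "CARD('d) \<in> {1, 2, 3}"
    and "\<And>i. a $ i < b $ i" and "\<Omega> = box a b"
    and "tensor_partition a b P"
    and "\<Delta>t > 0"
    and "m \<in> S1 \<Omega> P" and "\<And>z. z \<in> nodes P \<Longrightarrow> norm (m z) = 1"
  shows "(\<forall>mt m'. projection_scheme \<Omega> P \<Delta>t m mt m' \<longleftrightarrow>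
            tangent_plane_scheme \<Omega> P \<Delta>t m (\<lambda>x. (mt x - m x) /\<^sub>R \<Delta>t) m')
       \<and> (\<forall>u m'. tangent_plane_scheme \<Omega> P \<Delta>t m u m' \<longleftrightarrow>
            projection_scheme \<Omega> P \<Delta>t m (\<lambda>x. m x + \<Delta>t *\<^sub>R u x) m')
       \<and> (\<forall>mt m'. projection_scheme \<Omega> P \<Delta>t m mt m' \<longrightarrow> (\<forall>z\<in>nodes P. mt z \<noteq> 0))"
proof -
  interpret tensor_mesh a b P by unfold_locales (rule assms(4))
  have equiv: "projection_scheme \<Omega> P \<Delta>t m mt m' \<longleftrightarrow>
      tangent_plane_scheme \<Omega> P \<Delta>t m (\<lambda>x. (mt x - m x) /\<^sub>R \<Delta>t) m'" for mt m'
    using projection_scheme_iff_tangent_plane_scheme[of \<Delta>t m mt m'] assms(3,5,6,7) by simp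
  moreover have "tangent_plane_scheme \<Omega> P \<Delta>t m u m' \<longleftrightarrow>
      projection_scheme \<Omega> P \<Delta>t m (\<lambda>x. m x + \<Delta>t *\<^sub>R u x) m'" for u m'
    using assms(5) by (simp add: equiv)
  moreover have "mt z \<noteq> 0" if "projection_scheme \<Omega> P \<Delta>t m mt m'" "z \<in> nodes P" for mt m' z
  proof
    assume "mt z = 0"
    \<comment> \<open>If \<open>mt z\<close> were 0, the increment at \<open>z\<close> would be a
      multiple of \<open>m z\<close> and orthogonal to it, forcing \<open>m z = 0\<close>.\<close>
    moreover have "((mt z - m z) /\<^sub>R \<Delta>t) \<bullet> m z = 0"
      using that unfolding equiv tangent_plane_scheme_def tangent_space_def by blast
    ultimately have "m z = 0" using assms(5) by simp
    then show False using assms(7)[OF that(2)] by simp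
  qed
  ultimately show ?thesis by blast
qed

end
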